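(* Let $\mathbb{F}$ be any field. For $k\ge 1$ let $R_k=\begin{bmatrix}1&1\\1&0\end{bmatrix}^{\otimes k}\in\mathbb{F}^{N\times N}$ be the disjointness matrix, where $N=2^k$. Then, as $k\to\infty$, $R_k$ has a depth-2 linear circuit over $\mathbb{F}$ of size $O(N^{1.249424})$. More generally, for any fixed even positive integer $d$, $R_k$ has a depth-$d$ linear circuit over $\mathbb{F}$ of size $O(N^{1+0.498848/d})$.
   Context: For a matrix $A$, $A^{\otimes k}$ is the $k$-fold Kronecker power and $\operatorname{nnz}(A)$ is the number of nonzero entries of $A$. A depth-$d$ linear circuit over $\mathbb{F}$ computing a matrix $M$ is a factorization $M=A_1A_2\cdots A_d$ into $d$ matrices over $\mathbb{F}$ (with arbitrary intermediate dimensions); its size is $\sum_{i=1}^d\operatorname{nnz}(A_i)$. In particular a depth-2 circuit is $M=UV^{\mathsf T}$ with size $\operatorname{nnz}(U)+\operatorname{nnz}(V)$. The constant in $O(\cdot)$ may depend on the fixed depth $d$ but not on $k$. *)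

theory Defs
  imports Complex_Main "HOL-Library.Landau_Symbols" "Jordan_Normal_Form.Matrix"
begin

definition kronecker :: "'a::semiring_1 mat \<Rightarrow> 'a mat \<Rightarrow> 'a mat" where
  "kronecker A B = mat (dim_row A * dim_row B) (dim_col A * dim_col B)
     (\<lambda>(i, j). A $$ (i div dim_row B, j div dim_col B) * B $$ (i mod dim_row B, j mod dim_col B))"

primrec kronecker_power :: "'a::semiring_1 mat \<Rightarrow> nat \<Rightarrow> 'a mat" where
  "kronecker_power A 0 = 1\<^sub>m 1"
| "kronecker_power A (Suc k) = kronecker A (kronecker_power A k)"

definition disjointness_mat :: "nat \<Rightarrow> 'a::semiring_1 mat" where
  "disjointness_mat k = kronecker_power (mat_of_rows_list 2 [[1, 1], [1, 0]]) k"

definition nnz :: "'a::zero mat \<Rightarrow> nat" where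
  "nnz A = card {(i, j). i < dim_row A \<and> j < dim_col A \<and> A $$ (i, j) \<noteq> 0}"

text \<open>The list \<open>[A\<^sub>1, \<dots>, A\<^sub>d]\<close> with \<open>d \<ge> 1\<close> is a circuit for \<open>M\<close> if
  \<open>M = A\<^sub>1 * (\<dots> * A\<^sub>d)\<close>. Matrix multiplication in the library is total, so the
  compatibility of adjacent dimensions has to be required separately.\<close>

definition linear_circuit :: "nat \<Rightarrow> 'a::semiring_1 mat \<Rightarrow> 'a mat list \<Rightarrow> bool" where
  "linear_circuit d M As \<longleftrightarrow>
     length As = d \<and> As \<noteq> [] \<and>
     successively (\<lambda>A B. dim_col A = dim_row B) As \<and>
     M = foldr (*) (butlast As) (last As)"

definition circuit_size :: "'a::zero mat list \<Rightarrow> nat" where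
  "circuit_size As = (\<Sum>A\<leftarrow>As. nnz A)"

end

theory Submission
  imports Defs
begin

text \<open>A factorization \<open>M = U V\<close> writes \<open>M\<close> as a sum of rank-one matrices \<open>u v\<^sup>T\<close>. Under Kronecker products the pairs
  \<open>(nnz u, nnz v)\<close> multiply, so what matters is the sum of \<open>sqrt (nnz u * nnz v)\<close>, provided that the
  two sides stay balanced. Since \<open>R\<^sub>k\<close> is symmetric, balance is achieved by choosing, at each stage
  and for each rank-one matrix obtained so far, a decomposition or its transpose according to the
  present imbalance; a potential function that smoothly interpolates between the slopes of
  \<open>max a b\<close> in logarithmic coordinates makes this precise. It then remains to find, for every exponent
  \<open>t\<close> between \<open>1/2\<close> and \<open>1\<close>, a decomposition with small sum of \<open>nnz u powr t * nnz v powr (1 - t)\<close>.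

  Rows and columns of \<open>R\<^sub>4\<close> are indexed by subsets of a four-element set. Split off the row and
  the column of the empty set; the remaining core \<open>X\<close> is not decomposed at once, but its
  Kronecker cube is: an entry indexed by disjoint triples of sets \<open>S\<close>, \<open>T\<close> is put into the row of
  \<open>S\<close> if \<open>S\<close> has at most as many elements as \<open>T\<close>, and into the column of \<open>T\<close> otherwise. At \<open>t = 1/2\<close>
  the cost of \<open>X\<close> per factor is then below \<open>24.049\<close> and that of \<open>R\<^sub>4\<close> below \<open>31.9488\<close>, whose
  logarithm to base \<open>16\<close> is less than \<open>1.249424\<close>. For \<open>t \<ge> 7/13\<close> plain rows suffice.\<close>

section \<open>Kronecker products and sparsity\<close>

lemma sum_div_mod:
  fixes f :: "nat \<Rightarrow> nat \<Rightarrow> 'a::comm_monoid_add"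
  shows "(\<Sum>k<m * n. f (k div n) (k mod n)) = (\<Sum>i<m. \<Sum>j<n. f i j)"
proof (cases "n = 0")
  case False
  have "(\<Sum>k<m * n. f (k div n) (k mod n)) = (\<Sum>(i, j)\<in>{..<m} \<times> {..<n}. f i j)"
  proof (rule sum.reindex_bij_witness[where i = "\<lambda>(i, j). i * n + j" and j = "\<lambda>k. (k div n, k mod n)"])
    show "(case x of (i, j) \<Rightarrow> i * n + j) \<in> {..<m * n}" if "x \<in> {..<m} \<times> {..<n}" for x
    proof (cases x)
      case (Pair i j)
      have "i * n + j < Suc i * n"
        using that Pair by simp
      also have "\<dots> \<le> m * n"
        using that Pair by (intro mult_right_mono) auto
      finally show ?thesis
        using Pair by simp
    qed
  qed (use False in \<open>auto simp: less_mult_imp_div_less\<close>)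
  then show ?thesis
    by (simp add: sum.cartesian_product)
qed simp

lemma dim_kronecker [simp]:
  "dim_row (kronecker A B) = dim_row A * dim_row B"
  "dim_col (kronecker A B) = dim_col A * dim_col B"
  by (simp_all add: kronecker_def)

lemma index_kronecker [simp]:
  assumes "i < dim_row A * dim_row B" "j < dim_col A * dim_col B"
  shows "kronecker A B $$ (i, j) =
    A $$ (i div dim_row B, j div dim_col B) * B $$ (i mod dim_row B, j mod dim_col B)"
  using assms by (simp add: kronecker_def)

lemma mod_less_of_less_mult: "i mod n < n" if "i < m * n" for i m n :: nat
  using that by (cases "n = 0") auto

text \<open>The inner summation index splits into quotient and remainder, so the sum over it factors
  into two independent sums; commutativity reorders the scalars.\<close>

lemma kronecker_mult_mixed:
  fixes A :: "'a::comm_semiring_1 mat"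
  assumes "dim_col A = dim_row C" "dim_col B = dim_row D"
  shows "kronecker (A * C) (B * D) = kronecker A B * kronecker C D"
proof (rule eq_matI)
  fix i j
  assume ij: "i < dim_row (kronecker A B * kronecker C D)" "j < dim_col (kronecker A B * kronecker C D)"
  let ?i1 = "i div dim_row B" and ?i2 = "i mod dim_row B"
  let ?j1 = "j div dim_col D" and ?j2 = "j mod dim_col D"
  have i: "?i1 < dim_row A" "?i2 < dim_row B" and j: "?j1 < dim_col C" "?j2 < dim_col D"
    using ij by (auto simp: less_mult_imp_div_less mod_less_of_less_mult)
  have "(kronecker A B * kronecker C D) $$ (i, j) =
    (\<Sum>k<dim_row C * dim_row D. (A $$ (?i1, k div dim_row D) * B $$ (?i2, k mod dim_row D)) *
       (C $$ (k div dim_row D, ?j1) * D $$ (k mod dim_row D, ?j2)))"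
    using ij assms by (auto simp: scalar_prod_def lessThan_atLeast0 intro!: sum.cong)
  also have "\<dots> = (\<Sum>k<dim_row C. \<Sum>l<dim_row D. (A $$ (?i1, k) * B $$ (?i2, l)) * (C $$ (k, ?j1) * D $$ (l, ?j2)))"
    by (rule sum_div_mod)
  also have "\<dots> = (\<Sum>k<dim_row C. A $$ (?i1, k) * C $$ (k, ?j1)) * (\<Sum>l<dim_row D. B $$ (?i2, l) * D $$ (l, ?j2))"
    by (simp add: sum_product mult_ac)
  also have "\<dots> = kronecker (A * C) (B * D) $$ (i, j)"
    using ij i j assms by (simp add: scalar_prod_def lessThan_atLeast0)
  finally show "kronecker (A * C) (B * D) $$ (i, j) = (kronecker A B * kronecker C D) $$ (i, j)" ..
qed auto

text \<open>Both sides read off the same three mixed-radix digits of each index.\<close>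

lemma kronecker_assoc:
  fixes A :: "'a::semiring_1 mat"
  shows "kronecker (kronecker A B) C = kronecker A (kronecker B C)"
proof (rule eq_matI)
  fix i j
  assume ij: "i < dim_row (kronecker A (kronecker B C))" "j < dim_col (kronecker A (kronecker B C))"
  have pos: "dim_row C > 0" "dim_col C > 0"
    using ij by (auto intro!: Nat.gr0I)
  have "i div dim_row C < dim_row A * dim_row B" "j div dim_col C < dim_col A * dim_col B"
    using ij by (auto simp: less_mult_imp_div_less mult.assoc)
  then have 1: "kronecker (kronecker A B) C $$ (i, j) =
    A $$ (i div dim_row C div dim_row B, j div dim_col C div dim_col B) *
    B $$ (i div dim_row C mod dim_row B, j div dim_col C mod dim_col B) *
    C $$ (i mod dim_row C, j mod dim_col C)"
    using ij by (simp add: mult.assoc)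
  have "i mod (dim_row B * dim_row C) < dim_row B * dim_row C"
    "j mod (dim_col B * dim_col C) < dim_col B * dim_col C"
    using ij mod_less_of_less_mult by auto
  then have 2: "kronecker A (kronecker B C) $$ (i, j) =
    A $$ (i div (dim_row B * dim_row C), j div (dim_col B * dim_col C)) *
    (B $$ (i mod (dim_row B * dim_row C) div dim_row C, j mod (dim_col B * dim_col C) div dim_col C) *
    C $$ (i mod (dim_row B * dim_row C) mod dim_row C, j mod (dim_col B * dim_col C) mod dim_col C))"
    using ij by simp
  have div: "k div (b * c) = k div c div b" and modmod: "k mod (b * c) mod c = k mod c" for k b c :: nat
    by (metis div_mult2_eq mult.commute, simp add: mod_mod_cancel)
  have mod: "k mod (b * c) div c = k div c mod b" if "c > 0" for k b c :: nat
  proof -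
    have "k mod (b * c) = c * (k div c mod b) + k mod c"
      by (metis mod_mult2_eq mult.commute)
    then show ?thesis
      using that by simp
  qed
  show "kronecker (kronecker A B) C $$ (i, j) = kronecker A (kronecker B C) $$ (i, j)"
    unfolding 1 2 div modmod mod[OF pos(1)] mod[OF pos(2)] by (simp only: mult.assoc)
qed (auto simp: mult.assoc)

lemma kronecker_one_left [simp]: "kronecker (1\<^sub>m 1) A = (A :: 'a::semiring_1 mat)"
  by (rule eq_matI) auto

lemma kronecker_add_left:
  fixes A :: "'a::semiring_1 mat"
  assumes "dim_row A = dim_row B" "dim_col A = dim_col B"
  shows "kronecker (A + B) C = kronecker A C + kronecker B C"
  by (rule eq_matI) (use assms in \<open>auto simp: less_mult_imp_div_less distrib_right\<close>)

lemma transpose_kronecker: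
  "transpose_mat (kronecker A B) = kronecker (transpose_mat A) (transpose_mat B :: 'a::semiring_1 mat)"
  by (rule eq_matI) (auto simp: less_mult_imp_div_less mod_less_of_less_mult)

lemma kronecker_power_add:
  "kronecker_power A (m + n) = kronecker (kronecker_power A m) (kronecker_power A n)"
  by (induction m) (simp_all add: kronecker_assoc del: One_nat_def)

lemma dim_kronecker_power [simp]:
  "dim_row (kronecker_power A n) = dim_row A ^ n"
  "dim_col (kronecker_power A n) = dim_col A ^ n"
  by (induction n) auto

lemma transpose_kronecker_power:
  assumes "transpose_mat A = A"
  shows "transpose_mat (kronecker_power A n) = kronecker_power A n"
  by (induction n) (simp_all add: transpose_kronecker assms)

section \<open>Counting nonzero entries\<close>

lemma finite_nnz: "finite {(i, j). i < dim_row A \<and> j < dim_col A \<and> A $$ (i, j) \<noteq> 0}"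
  by (rule finite_subset[of _ "{..<dim_row A} \<times> {..<dim_col A}"]) auto

lemma nnz_le_of_inj:
  assumes "\<And>i j. i < dim_row A \<Longrightarrow> j < dim_col A \<Longrightarrow> A $$ (i, j) \<noteq> 0 \<Longrightarrow>
      p i < dim_row B \<and> q j < dim_col B \<and> B $$ (p i, q j) \<noteq> 0"
    and "inj_on p {..<dim_row A}" "inj_on q {..<dim_col A}"
  shows "nnz A \<le> nnz B"
  unfolding nnz_def
proof (rule card_inj_on_le[OF _ _ finite_nnz])
  show "inj_on (\<lambda>(i, j). (p i, q j)) {(i, j). i < dim_row A \<and> j < dim_col A \<and> A $$ (i, j) \<noteq> 0}"
    using assms(2,3) by (auto simp: inj_on_def)
qed (use assms(1) in auto)

lemma nnz_le_dim: "nnz A \<le> dim_row A * dim_col A"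
proof -
  have "nnz A \<le> card ({..<dim_row A} \<times> {..<dim_col A})"
    unfolding nnz_def by (rule card_mono) auto
  then show ?thesis by simp
qed

lemma nnz_one_le: "nnz (1\<^sub>m n :: 'a::semiring_1 mat) \<le> n"
proof -
  have "nnz (1\<^sub>m n :: 'a mat) \<le> card ((\<lambda>i. (i, i)) ` {..<n})"
    unfolding nnz_def by (rule card_mono) (auto split: if_splits)
  also have "\<dots> \<le> n"
    using card_image_le[of "{..<n}" "\<lambda>i. (i, i)"] by simp
  finally show ?thesis .
qed

lemma nnz_transpose: "nnz (transpose_mat A) = nnz A"
proof -
  have "{(i, j). i < dim_col A \<and> j < dim_row A \<and> transpose_mat A $$ (i, j) \<noteq> 0} =
     (\<lambda>(i, j). (j, i)) ` {(i, j). i < dim_row A \<and> j < dim_col A \<and> A $$ (i, j) \<noteq> 0}"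
    by auto
  then show ?thesis
    unfolding nnz_def by (simp add: card_image inj_on_def)
qed

lemma nnz_kronecker_le: "nnz (kronecker A B) \<le> nnz A * nnz B"
proof -
  let ?S = "\<lambda>A :: 'a mat. {(i, j). i < dim_row A \<and> j < dim_col A \<and> A $$ (i, j) \<noteq> 0}"
  have "nnz (kronecker A B) \<le> card (?S A \<times> ?S B)"
    unfolding nnz_def
  proof (rule card_inj_on_le)
    let ?f = "\<lambda>(i, j). ((i div dim_row B, j div dim_col B), (i mod dim_row B, j mod dim_col B))"
    show "inj_on ?f (?S (kronecker A B))"
      by (auto simp: inj_on_def) (metis mult_div_mod_eq)+
    show "?f ` ?S (kronecker A B) \<subseteq> ?S A \<times> ?S B"
      by (auto simp: less_mult_imp_div_less mod_less_of_less_mult)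
  qed (simp add: finite_nnz)
  then show ?thesis
    by (simp add: nnz_def card_cartesian_product)
qed

text \<open>Weighting the two factors separately makes the cost of a factorization behave well under
  Kronecker products with rank-one matrices, which scale the two weights.\<close>

definition cost_le :: "'a::semiring_1 mat \<Rightarrow> real \<Rightarrow> real \<Rightarrow> real \<Rightarrow> bool" where
  "cost_le M a b r \<longleftrightarrow>
     (\<exists>U V. dim_col U = dim_row V \<and> M = U * V \<and> a * real (nnz U) + b * real (nnz V) \<le> r)"

lemma cost_leI:
  "dim_col U = dim_row V \<Longrightarrow> M = U * V \<Longrightarrow> a * real (nnz U) + b * real (nnz V) \<le> r \<Longrightarrow> cost_le M a b r"
  unfolding cost_le_def by blast

lemma cost_leE:
  assumes "cost_le M a b r"
  obtains U V where "dim_col U = dim_row V" "M = U * V" "a * real (nnz U) + b * real (nnz V) \<le> r"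
  using assms unfolding cost_le_def by auto

lemma cost_le_mono: "cost_le M a b r \<Longrightarrow> r \<le> s \<Longrightarrow> cost_le M a b s"
  unfolding cost_le_def by force

lemma cost_le_transpose:
  fixes M :: "'a::comm_semiring_1 mat"
  assumes "cost_le M a b r"
  shows "cost_le (transpose_mat M) b a r"
proof -
  obtain U V where UV: "dim_col U = dim_row V" "M = U * V" "a * real (nnz U) + b * real (nnz V) \<le> r"
    using assms by (rule cost_leE)
  have "U \<in> carrier_mat (dim_row U) (dim_row V)" "V \<in> carrier_mat (dim_row V) (dim_col V)"
    using UV(1) by auto
  then have "transpose_mat M = transpose_mat V * transpose_mat U"
    unfolding UV(2) by (rule transpose_mult)
  moreover have "b * real (nnz (transpose_mat V)) + a * real (nnz (transpose_mat U)) \<le> r"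
    using UV(3) by (simp add: nnz_transpose)
  ultimately show ?thesis
    using UV(1) by (intro cost_leI) auto
qed

text \<open>The factorization is \<open>M = 1 * M\<close>. The bound is crude, but it serves only
  for matrices of bounded size at the base of the induction.\<close>

lemma cost_le_trivial:
  fixes M :: "'a::semiring_1 mat"
  assumes "a \<ge> 0" "b \<ge> 0"
  shows "cost_le M a b ((a + b) * real (dim_row M) * real (dim_row M + dim_col M))"
  unfolding cost_le_def
proof (intro exI conjI)
  have "nnz (1\<^sub>m (dim_row M) :: 'a mat) \<le> dim_row M * (dim_row M + dim_col M)"
    using nnz_le_dim[of "1\<^sub>m (dim_row M) :: 'a mat"] by (simp add: algebra_simps)
  moreover have "nnz M \<le> dim_row M * (dim_row M + dim_col M)"
    using nnz_le_dim[of M] by (simp add: algebra_simps)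
  ultimately have "a * real (nnz (1\<^sub>m (dim_row M) :: 'a mat)) + b * real (nnz M)
      \<le> a * real (dim_row M * (dim_row M + dim_col M)) + b * real (dim_row M * (dim_row M + dim_col M))"
    by (intro add_mono mult_left_mono) (use assms in \<open>auto simp del: of_nat_mult of_nat_add\<close>)
  then show "a * real (nnz (1\<^sub>m (dim_row M) :: 'a mat)) + b * real (nnz M)
      \<le> (a + b) * real (dim_row M) * real (dim_row M + dim_col M)"
    by (simp add: algebra_simps)
qed auto

text \<open>An inner dimension of zero gives two empty factors.\<close>

lemma cost_le_zero: "cost_le (0\<^sub>m m n :: 'a::semiring_1 mat) a b 0"
  unfolding cost_le_def
proof (intro exI conjI)
  show "(0\<^sub>m m n :: 'a mat) = 0\<^sub>m m 0 * 0\<^sub>m 0 n"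
    by (rule eq_matI) (auto simp: scalar_prod_def)
qed (auto simp: nnz_def)

text \<open>Placing the left factors side by side and stacking the right factors turns two products
  into their sum, and the numbers of nonzero entries add up.\<close>

lemma cost_le_add:
  fixes M N :: "'a::semiring_1 mat"
  assumes "cost_le M a b r" "cost_le N a b s"
    and dims: "dim_row M = dim_row N" "dim_col M = dim_col N"
    and nonneg: "a \<ge> 0" "b \<ge> 0"
  shows "cost_le (M + N) a b (r + s)"
proof -
  obtain U V where UV: "dim_col U = dim_row V" "M = U * V" "a * real (nnz U) + b * real (nnz V) \<le> r"
    using assms(1) by (rule cost_leE)
  obtain U' V' where UV': "dim_col U' = dim_row V'" "N = U' * V'" "a * real (nnz U') + b * real (nnz V') \<le> s"
    using assms(2) by (rule cost_leE)
  let ?p = "dim_row V" and ?q = "dim_row V'"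
  define P where "P = mat (dim_row U) (?p + ?q) (\<lambda>(i, k). if k < ?p then U $$ (i, k) else U' $$ (i, k - ?p))"
  define Q where "Q = mat (?p + ?q) (dim_col V) (\<lambda>(k, j). if k < ?p then V $$ (k, j) else V' $$ (k - ?p, j))"
  have eq: "dim_row U' = dim_row U" "dim_col V' = dim_col V"
    using dims UV UV' by auto
  have split: "(\<Sum>k<p + q. f k) = (\<Sum>k<p. f k) + (\<Sum>k<q. f (k + p))" for f :: "nat \<Rightarrow> 'a" and p q
    by (induction q) (simp_all add: ac_simps)
  have "M + N = P * Q"
  proof (rule eq_matI)
    fix i j assume "i < dim_row (P * Q)" "j < dim_col (P * Q)"
    then have ij: "i < dim_row U" "j < dim_col V" by (auto simp: P_def Q_def)
    have "(P * Q) $$ (i, j) = (\<Sum>k<?p + ?q. P $$ (i, k) * Q $$ (k, j))"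
      using ij by (simp add: P_def Q_def scalar_prod_def lessThan_atLeast0)
    also have "\<dots> = (\<Sum>k<?p. U $$ (i, k) * V $$ (k, j)) + (\<Sum>k<?q. U' $$ (i, k) * V' $$ (k, j))"
      unfolding split using ij by (simp add: P_def Q_def)
    also have "\<dots> = (M + N) $$ (i, j)"
      using ij UV UV' eq by (simp add: scalar_prod_def lessThan_atLeast0)
    finally show "(M + N) $$ (i, j) = (P * Q) $$ (i, j)" ..
  qed (use UV UV' eq in \<open>auto simp: P_def Q_def\<close>)
  moreover have "nnz P \<le> nnz U + nnz U'"
  proof -
    let ?S = "\<lambda>A :: 'a mat. {(i, j). i < dim_row A \<and> j < dim_col A \<and> A $$ (i, j) \<noteq> 0}"
    have "?S P \<subseteq> ?S U \<union> (\<lambda>(i, k). (i, k + ?p)) ` ?S U'"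
    proof safe
      fix i k assume *: "i < dim_row P" "k < dim_col P" "P $$ (i, k) \<noteq> 0"
        "(i, k) \<notin> (\<lambda>(i, k). (i, k + ?p)) ` ?S U'"
      have "k < ?p"
      proof (rule ccontr)
        assume "\<not> k < ?p"
        then have "(i, k) = (\<lambda>(i, k). (i, k + ?p)) (i, k - ?p)" "(i, k - ?p) \<in> ?S U'"
          using * UV' eq by (auto simp: P_def)
        then show False using *(4) by blast
      qed
      with * UV show "i < dim_row U" "k < dim_col U" "U $$ (i, k) = 0 \<Longrightarrow> False"
        by (auto simp: P_def)
    qed
    then have "nnz P \<le> card (?S U \<union> (\<lambda>(i, k). (i, k + ?p)) ` ?S U')"
      unfolding nnz_def by (rule card_mono[rotated]) (simp add: finite_nnz)
    also have "\<dots> \<le> nnz U + nnz U'"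
      unfolding nnz_def
      by (rule order_trans[OF card_Un_le]) (simp add: card_image_le finite_nnz)
    finally show ?thesis .
  qed
  moreover have "nnz Q \<le> nnz V + nnz V'"
  proof -
    let ?S = "\<lambda>A :: 'a mat. {(i, j). i < dim_row A \<and> j < dim_col A \<and> A $$ (i, j) \<noteq> 0}"
    have "?S Q \<subseteq> ?S V \<union> (\<lambda>(k, j). (k + ?p, j)) ` ?S V'"
    proof safe
      fix k j assume *: "k < dim_row Q" "j < dim_col Q" "Q $$ (k, j) \<noteq> 0"
        "(k, j) \<notin> (\<lambda>(k, j). (k + ?p, j)) ` ?S V'"
      have "k < ?p"
      proof (rule ccontr)
        assume "\<not> k < ?p"
        then have "(k, j) = (\<lambda>(k, j). (k + ?p, j)) (k - ?p, j)" "(k - ?p, j) \<in> ?S V'"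
          using * UV' eq by (auto simp: Q_def)
        then show False using *(4) by blast
      qed
      with * UV show "k < dim_row V" "j < dim_col V" "V $$ (k, j) = 0 \<Longrightarrow> False"
        by (auto simp: Q_def)
    qed
    then have "nnz Q \<le> card (?S V \<union> (\<lambda>(k, j). (k + ?p, j)) ` ?S V')"
      unfolding nnz_def by (rule card_mono[rotated]) (simp add: finite_nnz)
    also have "\<dots> \<le> nnz V + nnz V'"
      unfolding nnz_def
      by (rule order_trans[OF card_Un_le]) (simp add: card_image_le finite_nnz)
    finally show ?thesis .
  qed
  ultimately have "a * real (nnz P) \<le> a * real (nnz U) + a * real (nnz U')"
    "b * real (nnz Q) \<le> b * real (nnz V) + b * real (nnz V')"
    using nonneg by (simp_all flip: distrib_left of_nat_add add: mult_left_mono)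
  then have "a * real (nnz P) + b * real (nnz Q) \<le> r + s"
    using UV(3) UV'(3) by linarith
  moreover have "dim_col P = dim_row Q" by (simp add: P_def Q_def)
  ultimately show ?thesis
    using \<open>M + N = P * Q\<close> by (intro cost_leI)
qed

lemma cost_le_weights_mono:
  assumes "cost_le M a' b' r" "a \<le> a'" "b \<le> b'"
  shows "cost_le M a b r"
proof -
  obtain U V where UV: "dim_col U = dim_row V" "M = U * V" "a' * real (nnz U) + b' * real (nnz V) \<le> r"
    using assms(1) by (rule cost_leE)
  have "a * real (nnz U) \<le> a' * real (nnz U)" "b * real (nnz V) \<le> b' * real (nnz V)"
    using assms by (simp_all add: mult_right_mono)
  then show ?thesis
    using UV by (intro cost_leI) auto
qed

lemma cost_le_sum:
  fixes N :: "'i \<Rightarrow> 'a::semiring_1 mat"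
  assumes "finite Q" "\<And>q. q \<in> Q \<Longrightarrow> N q \<in> carrier_mat m n \<and> cost_le (N q) a b (r q)"
    and "a \<ge> 0" "b \<ge> 0"
  shows "cost_le (mat m n (\<lambda>ij. \<Sum>q\<in>Q. N q $$ ij)) a b (\<Sum>q\<in>Q. r q)"
  using assms(1,2)
proof (induction Q rule: finite_induct)
  case empty
  have "mat m n (\<lambda>ij. \<Sum>q\<in>{}. N q $$ ij) = 0\<^sub>m m n"
    by (rule eq_matI) auto
  then show ?case
    using cost_le_zero by simp
next
  case (insert q Q)
  have "mat m n (\<lambda>ij. \<Sum>q\<in>insert q Q. N q $$ ij) = N q + mat m n (\<lambda>ij. \<Sum>q\<in>Q. N q $$ ij)"
    using insert by (intro eq_matI) auto
  moreover have "cost_le (N q + mat m n (\<lambda>ij. \<Sum>q\<in>Q. N q $$ ij)) a b (r q + (\<Sum>q\<in>Q. r q))"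
    using insert assms(3,4) by (intro cost_le_add) auto
  ultimately show ?case
    using insert by simp
qed

text \<open>Selecting rows of \<open>U\<close> by \<open>p\<close> and columns of \<open>V\<close>
  by \<open>q\<close> factors the reindexed matrix; injectivity ensures that no nonzero entry is
  duplicated.\<close>

lemma cost_le_reindex:
  fixes M N :: "'a::semiring_1 mat"
  assumes "cost_le N a b r" "a \<ge> 0" "b \<ge> 0"
    and p: "inj_on p {..<dim_row M}" "p ` {..<dim_row M} \<subseteq> {..<dim_row N}"
    and q: "inj_on q {..<dim_col M}" "q ` {..<dim_col M} \<subseteq> {..<dim_col N}"
    and M: "\<And>i j. i < dim_row M \<Longrightarrow> j < dim_col M \<Longrightarrow> M $$ (i, j) = N $$ (p i, q j)"
  shows "cost_le M a b r"
proof -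
  obtain U V where UV: "dim_col U = dim_row V" "N = U * V" "a * real (nnz U) + b * real (nnz V) \<le> r"
    using assms(1) by (rule cost_leE)
  define U' where "U' = mat (dim_row M) (dim_col U) (\<lambda>(i, k). U $$ (p i, k))"
  define V' where "V' = mat (dim_row V) (dim_col M) (\<lambda>(k, j). V $$ (k, q j))"
  have pq: "p i < dim_row U" "q j < dim_col V" if "i < dim_row M" "j < dim_col M" for i j
    using p(2) q(2) that UV(2) by auto
  have "M = U' * V'"
  proof (rule eq_matI)
    fix i j assume "i < dim_row (U' * V')" "j < dim_col (U' * V')"
    then have ij: "i < dim_row M" "j < dim_col M"
      by (auto simp: U'_def V'_def)
    show "M $$ (i, j) = (U' * V') $$ (i, j)"
      using ij pq[OF ij] UV(1) by (simp add: M UV(2) U'_def V'_def scalar_prod_def)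
  qed (auto simp: U'_def V'_def)
  moreover have "nnz U' \<le> nnz U"
    by (rule nnz_le_of_inj[where p = p and q = "\<lambda>k. k"]) (use p UV(2) in \<open>auto simp: U'_def\<close>)
  then have "a * real (nnz U') \<le> a * real (nnz U)"
    using assms(2) by (simp add: mult_left_mono)
  moreover have "nnz V' \<le> nnz V"
    by (rule nnz_le_of_inj[where p = "\<lambda>k. k" and q = q]) (use q UV(2) in \<open>auto simp: V'_def\<close>)
  then have "b * real (nnz V') \<le> b * real (nnz V)"
    using assms(3) by (simp add: mult_left_mono)
  ultimately show ?thesis
    using UV by (intro cost_leI[of U' V']) (auto simp: U'_def V'_def)
qed

text \<open>Interchanging Kronecker factors only permutes rows and columns, which does not change
  sparsity.\<close>

lemma cost_le_kronecker_swap: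
  fixes A B C :: "'a::comm_semiring_1 mat"
  assumes "cost_le (kronecker B (kronecker A C)) a b r" "a \<ge> 0" "b \<ge> 0"
  shows "cost_le (kronecker A (kronecker B C)) a b r"
proof -
  \<comment> \<open>\<open>\<sigma>\<close> exchanges the two leading digits: it sends
    \<open>(x * n + y) * c + z\<close> to \<open>(y * m + x) * c + z\<close>.\<close>
  define \<sigma> where "\<sigma> m n c i = ((i div c) mod n * m + i div c div n) * c + i mod c" for m n c i :: nat
  have \<sigma>: "\<sigma> m n c i div c = (i div c) mod n * m + i div c div n" "\<sigma> m n c i mod c = i mod c"
    "\<sigma> m n c i div c div m = i div c mod n" "\<sigma> m n c i div c mod m = i div c div n"
    "\<sigma> m n c i < n * m * c"
    if "i < m * n * c" for i m n c
  proof -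
    have pos: "c > 0" "n > 0" "m > 0"
      using that by (auto intro!: Nat.gr0I)
    have lt: "i div c div n < m"
      using that by (simp add: less_mult_imp_div_less)
    show 1: "\<sigma> m n c i div c = (i div c) mod n * m + i div c div n" "\<sigma> m n c i mod c = i mod c"
      using pos by (simp_all add: \<sigma>_def)
    show "\<sigma> m n c i div c div m = i div c mod n" "\<sigma> m n c i div c mod m = i div c div n"
      unfolding 1 using lt by simp_all
    have "\<sigma> m n c i div c < n * m"
      unfolding 1 using lt mod_less_divisor[OF pos(2), of "i div c"]
      by (metis add_less_cancel_left mult_Suc_right Suc_leI mult_le_mono2 mult.commute order_less_le_trans add.commute)
    then show "\<sigma> m n c i < n * m * c"
      using pos(1) by (simp add: div_less_iff_less_mult)
  qed
  have inj: "inj_on (\<sigma> m n c) {..<m * n * c}" for m n c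
  proof (rule inj_onI)
    fix i j assume ij: "i \<in> {..<m * n * c}" "j \<in> {..<m * n * c}" "\<sigma> m n c i = \<sigma> m n c j"
    have "i div c mod n = j div c mod n" "i div c div n = j div c div n" "i mod c = j mod c"
      using ij \<sigma>(2,3,4)[of i m n c] \<sigma>(2,3,4)[of j m n c] by auto
    then show "i = j"
      by (metis mult_div_mod_eq)
  qed
  let ?M = "kronecker (kronecker A B) C" and ?N = "kronecker (kronecker B A) C"
  have "cost_le ?M a b r"
  proof (rule cost_le_reindex[OF _ assms(2,3)])
    show "cost_le ?N a b r"
      using assms(1) by (simp add: kronecker_assoc)
    let ?p = "\<sigma> (dim_row A) (dim_row B) (dim_row C)" and ?q = "\<sigma> (dim_col A) (dim_col B) (dim_col C)"
    show "inj_on ?p {..<dim_row ?M}" "inj_on ?q {..<dim_col ?M}"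
      using inj by auto
    show "?p ` {..<dim_row ?M} \<subseteq> {..<dim_row ?N}" "?q ` {..<dim_col ?M} \<subseteq> {..<dim_col ?N}"
      using \<sigma>(5) by auto
    fix i j assume "i < dim_row ?M" "j < dim_col ?M"
    then have i: "i < dim_row A * dim_row B * dim_row C" and j: "j < dim_col A * dim_col B * dim_col C"
      by simp_all
    have "i div dim_row C < dim_row A * dim_row B" "j div dim_col C < dim_col A * dim_col B"
      using i j by (auto simp: less_mult_imp_div_less)
    moreover have "?p i div dim_row C < dim_row B * dim_row A" "?q j div dim_col C < dim_col B * dim_col A"
      using \<sigma>(5)[OF i] \<sigma>(5)[OF j] by (auto simp: less_mult_imp_div_less)
    ultimately show "?M $$ (i, j) = ?N $$ (?p i, ?q j)"
      using i j \<sigma>(2-5)[OF i] \<sigma>(2-5)[OF j] by (simp del: \<sigma>(1) add: mult.commute)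
  qed
  then show ?thesis
    by (simp add: kronecker_assoc)
qed

text \<open>If \<open>Z = U * V\<close>, the mixed-product rule gives the factors
  \<open>kronecker P U\<close> and \<open>kronecker Q V\<close>. The sparsity of \<open>P\<close>
  and \<open>Q\<close> thus becomes a change of the two weights for \<open>Z\<close>.\<close>

lemma cost_le_kronecker_product:
  fixes P Q Z :: "'a::comm_semiring_1 mat"
  assumes "cost_le Z (a * real (nnz P)) (b * real (nnz Q)) r" "dim_col P = dim_row Q" "a \<ge> 0" "b \<ge> 0"
  shows "cost_le (kronecker (P * Q) Z) a b r"
proof -
  obtain U V where UV: "dim_col U = dim_row V" "Z = U * V"
    "a * real (nnz P) * real (nnz U) + b * real (nnz Q) * real (nnz V) \<le> r"
    using assms(1) by (rule cost_leE)
  have "real (nnz (kronecker P U)) \<le> real (nnz P) * real (nnz U)"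
    "real (nnz (kronecker Q V)) \<le> real (nnz Q) * real (nnz V)"
    using nnz_kronecker_le[of P U] nnz_kronecker_le[of Q V] by (simp_all flip: of_nat_mult)
  then have "a * real (nnz (kronecker P U)) \<le> a * real (nnz P) * real (nnz U)"
    "b * real (nnz (kronecker Q V)) \<le> b * real (nnz Q) * real (nnz V)"
    using assms(3,4) by (simp_all add: mult_left_mono mult.assoc)
  then show ?thesis
    using UV assms(2) by (intro cost_leI[of "kronecker P U" "kronecker Q V"]) (auto simp: kronecker_mult_mixed)
qed

text \<open>\<open>M\<close> is the sum of its rows, each a unit column vector times a row vector. A
  row leaves the first weight at \<open>a\<close> and multiplies the second by its number of
  entries; rows with \<open>d i = 0\<close> are left out, so that all weights passed on to
  \<open>Z\<close> come from positive factors.\<close>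

lemma cost_le_kronecker_rows:
  fixes M Z :: "'a::comm_semiring_1 mat"
  assumes M: "M \<in> carrier_mat m n"
    and d: "\<And>i. i < m \<Longrightarrow> card {j. j < n \<and> M $$ (i, j) \<noteq> 0} \<le> d i"
    and Z: "\<And>y. y > 0 \<Longrightarrow> cost_le Z a (b * real y) (g y)"
    and nonneg: "a \<ge> 0" "b \<ge> 0"
  shows "cost_le (kronecker M Z) a b (\<Sum>i | i < m \<and> d i > 0. g (d i))"
proof -
  let ?Q = "{i. i < m \<and> d i > 0}"
  define u where "u i = mat m 1 (\<lambda>(x, _). if x = i then 1 else 0 :: 'a)" for i :: nat
  define v where "v i = mat 1 n (\<lambda>(_, j). M $$ (i, j))" for i :: nat
  have "cost_le (kronecker (u i * v i) Z) a b (g (d i))" if "i < m" "d i > 0" for i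
  proof (rule cost_le_kronecker_product)
    have "nnz (u i) \<le> card {(i, 0 :: nat)}"
      unfolding nnz_def u_def by (rule card_mono) (auto split: if_splits)
    then have "a * real (nnz (u i)) \<le> a"
      using nonneg by (simp add: mult_left_le)
    moreover have "nnz (v i) \<le> card (Pair (0 :: nat) ` {j. j < n \<and> M $$ (i, j) \<noteq> 0})"
      unfolding nnz_def v_def by (rule card_mono) auto
    then have "nnz (v i) \<le> d i"
      using d[OF that(1)] by (simp add: card_image inj_on_def)
    then have "b * real (nnz (v i)) \<le> b * real (d i)"
      using nonneg by (simp add: mult_left_mono)
    ultimately show "cost_le Z (a * real (nnz (u i))) (b * real (nnz (v i))) (g (d i))"
      by (rule cost_le_weights_mono[OF Z[OF that(2)]])
  qed (use nonneg in \<open>auto simp: u_def v_def\<close>)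
  then have "cost_le (mat (m * dim_row Z) (n * dim_col Z) (\<lambda>ij. \<Sum>i\<in>?Q. kronecker (u i * v i) Z $$ ij)) a b
      (\<Sum>i\<in>?Q. g (d i))"
    using nonneg by (intro cost_le_sum) (auto simp: u_def v_def intro!: carrier_matI)
  moreover have "mat (m * dim_row Z) (n * dim_col Z) (\<lambda>ij. \<Sum>i\<in>?Q. kronecker (u i * v i) Z $$ ij) = kronecker M Z"
  proof (rule eq_matI)
    fix x y assume "x < dim_row (kronecker M Z)" "y < dim_col (kronecker M Z)"
    then have xy: "x < m * dim_row Z" "y < n * dim_col Z"
      using M by auto
    then have xy': "x div dim_row Z < m" "y div dim_col Z < n"
      by (auto simp: less_mult_imp_div_less)
    let ?z = "Z $$ (x mod dim_row Z, y mod dim_col Z)" and ?w = "M $$ (x div dim_row Z, y div dim_col Z)"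
    have "(\<Sum>i\<in>?Q. kronecker (u i * v i) Z $$ (x, y)) = (\<Sum>i\<in>?Q. if i = x div dim_row Z then ?w * ?z else 0)"
      using xy xy' by (intro sum.cong) (auto simp: u_def v_def scalar_prod_def)
    also have "\<dots> = ?w * ?z"
    proof (cases "d (x div dim_row Z) > 0")
      \<comment> \<open>A row left out of the sum is zero, so nothing is lost.\<close>
      case False
      have "finite {j. j < n \<and> M $$ (x div dim_row Z, j) \<noteq> 0}" by simp
      then have "{j. j < n \<and> M $$ (x div dim_row Z, j) \<noteq> 0} = {}"
        using d[OF xy'(1)] False by simp
      then have "?w = 0"
        using xy' by blast
      then show ?thesis by simp
    qed (use xy' in simp)
    finally show "mat (m * dim_row Z) (n * dim_col Z) (\<lambda>ij. \<Sum>i\<in>?Q. kronecker (u i * v i) Z $$ ij) $$ (x, y) = kronecker M Z $$ (x, y)"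
      using M xy by simp
  qed (use M in auto)
  ultimately show ?thesis by simp
qed

text \<open>The row version applied to the transposes, with the weights exchanged.\<close>

lemma cost_le_kronecker_cols:
  fixes M Z :: "'a::comm_semiring_1 mat"
  assumes M: "M \<in> carrier_mat m n"
    and e: "\<And>j. j < n \<Longrightarrow> card {i. i < m \<and> M $$ (i, j) \<noteq> 0} \<le> e j"
    and Z: "\<And>x. x > 0 \<Longrightarrow> cost_le Z (a * real x) b (g x)"
    and nonneg: "a \<ge> 0" "b \<ge> 0"
  shows "cost_le (kronecker M Z) a b (\<Sum>j | j < n \<and> e j > 0. g (e j))"
proof -
  have "cost_le (kronecker (transpose_mat M) (transpose_mat Z)) b a (\<Sum>j | j < n \<and> e j > 0. g (e j))"
  proof (rule cost_le_kronecker_rows)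
    fix j assume "j < n"
    then have "{i. i < m \<and> transpose_mat M $$ (j, i) \<noteq> 0} = {i. i < m \<and> M $$ (i, j) \<noteq> 0}"
      using M by auto
    then show "card {i. i < m \<and> transpose_mat M $$ (j, i) \<noteq> 0} \<le> e j"
      using e[OF \<open>j < n\<close>] by simp
  qed (use M Z nonneg in \<open>auto intro: cost_le_transpose\<close>)
  then show ?thesis
    using cost_le_transpose by (fastforce simp flip: transpose_kronecker)
qed

section \<open>The potential\<close>

text \<open>For \<open>K = 0\<close> and positive weights this is \<open>max a b\<close>; a positive
  \<open>K\<close> rounds off the corner at \<open>a = b\<close>.\<close>

definition potential :: "real \<Rightarrow> real \<Rightarrow> real \<Rightarrow> real" where
  "potential K a b = sqrt (a * b) * exp (sqrt ((ln (a / b))\<^sup>2 + K\<^sup>2) / 2)"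

text \<open>The partial derivative of \<open>ln (potential K a b)\<close> with respect to
  \<open>ln a\<close>; the derivative with respect to \<open>ln b\<close> is
  \<open>1 - tilt K a b\<close>.\<close>

definition tilt :: "real \<Rightarrow> real \<Rightarrow> real \<Rightarrow> real" where
  "tilt K a b = 1 / 2 + ln (a / b) / (2 * sqrt ((ln (a / b))\<^sup>2 + K\<^sup>2))"

lemma potential_pos: "a > 0 \<Longrightarrow> b > 0 \<Longrightarrow> potential K a b > 0"
  by (simp add: potential_def)

lemma potential_commute: "a > 0 \<Longrightarrow> b > 0 \<Longrightarrow> potential K a b = potential K b a"
  by (simp add: potential_def mult.commute ln_div power2_commute)

lemma le_potential_left:
  assumes "a > 0" "b > 0"
  shows "a \<le> potential K a b"
proof -
  have "ln (a / b) \<le> sqrt ((ln (a / b))\<^sup>2 + K\<^sup>2)"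
    by (rule real_le_rsqrt) simp
  then have "exp (ln (a / b) / 2) \<le> exp (sqrt ((ln (a / b))\<^sup>2 + K\<^sup>2) / 2)"
    by simp
  then have "sqrt (a * b) * exp (ln (a / b) / 2) \<le> potential K a b"
    unfolding potential_def using assms by (intro mult_left_mono) auto
  moreover have "sqrt (a * b) * exp (ln (a / b) / 2) = a"
  proof -
    have "sqrt (a * b) = exp (ln (a * b) / 2)"
      using assms by (simp add: ln_sqrt[symmetric])
    then show ?thesis
      using assms by (simp add: ln_mult ln_div flip: exp_add) (simp add: field_simps)
  qed
  ultimately show ?thesis by simp
qed

lemma le_potential_right: "a > 0 \<Longrightarrow> b > 0 \<Longrightarrow> b \<le> potential K a b"
  using le_potential_left[of b a K] potential_commute[of a b K] by simp

lemma tilt_bounds: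
  assumes "K > 0" "a > 0" "b > 0" "a \<ge> b"
  shows "1 / 2 \<le> tilt K a b" "tilt K a b \<le> 1"
proof -
  let ?x = "ln (a / b)" and ?s = "sqrt ((ln (a / b))\<^sup>2 + K\<^sup>2)"
  have "?x \<ge> 0"
    using assms by simp
  moreover have "?x \<le> ?s"
    by (rule real_le_rsqrt) simp
  moreover have "?s > 0"
    using assms by (simp add: sum_power2_gt_zero_iff)
  ultimately show "1 / 2 \<le> tilt K a b" "tilt K a b \<le> 1"
    by (simp_all add: tilt_def field_simps)
qed

text \<open>The exponent of the potential is a smoothing of \<open>\<bar>ln (a / b)\<bar> / 2\<close> whose slope changes so slowly
  that a bounded factor acts on the potential almost like a power with exponent \<open>tilt K a b\<close>.\<close>

lemma potential_step:
  assumes "K > 0" "a > 0" "b > 0" "1 \<le> x" "x \<le> M" "1 \<le> y" "y \<le> M"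
  shows "potential K (a * x) (b * y) \<le>
    potential K a b * (x powr tilt K a b * y powr (1 - tilt K a b)) * exp ((ln M)\<^sup>2 / (4 * K))"
proof -
  define w l s where "w = ln (a / b)" and "l = ln (x / y)" and "s = sqrt (w\<^sup>2 + K\<^sup>2)"
  have M: "M \<ge> 1" using assms by linarith
  have s: "s \<ge> K" "s > 0" "s\<^sup>2 = w\<^sup>2 + K\<^sup>2"
    using assms by (auto intro!: real_le_rsqrt simp: s_def sum_power2_gt_zero_iff)
  have l: "l\<^sup>2 \<le> (ln M)\<^sup>2"
  proof -
    have "ln x \<le> ln M" "ln y \<le> ln M" "0 \<le> ln x" "0 \<le> ln y" "l = ln x - ln y"
      using assms by (auto simp: l_def ln_div)
    then have "\<bar>l\<bar> \<le> ln M"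
      by linarith
    then show ?thesis
      by (metis abs_ge_zero power2_abs power_mono)
  qed
  have ln: "ln (a * x / (b * y)) = w + l"
    using assms by (simp add: w_def l_def ln_div ln_mult)
  \<comment> \<open>The radicand is \<open>s\<^sup>2 + e\<close> with
    \<open>e = 2 * w * l + l\<^sup>2\<close>, and completing the square bounds its root by
    \<open>s + e / (2 * s)\<close>. The linear part yields the tilt; the quadratic part is
    controlled by \<open>s \<ge> K\<close>.\<close>
  have "sqrt ((w + l)\<^sup>2 + K\<^sup>2) \<le> s + w * l / s + (ln M)\<^sup>2 / (2 * K)"
  proof -
    have "(w + l)\<^sup>2 + K\<^sup>2 = s\<^sup>2 + (2 * w * l + l\<^sup>2)"
      by (simp add: s(3) power2_sum)
    also have "\<dots> \<le> s\<^sup>2 + (2 * w * l + l\<^sup>2) + ((2 * w * l + l\<^sup>2) / (2 * s))\<^sup>2"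
      by simp
    also have "\<dots> = (s + (2 * w * l + l\<^sup>2) / (2 * s))\<^sup>2"
      using s(2) by (simp add: power2_sum)
    finally have "sqrt ((w + l)\<^sup>2 + K\<^sup>2) \<le> \<bar>s + (2 * w * l + l\<^sup>2) / (2 * s)\<bar>"
      by (metis real_sqrt_abs real_sqrt_le_mono)
    moreover have "s + (2 * w * l + l\<^sup>2) / (2 * s) \<ge> 0"
    proof -
      have "s + (2 * w * l + l\<^sup>2) / (2 * s) = (s\<^sup>2 + (w + l)\<^sup>2 + K\<^sup>2) / (2 * s)"
        using s(2,3) by (simp add: field_simps power2_eq_square)
      then show ?thesis using s(2) by simp
    qed
    moreover have "l\<^sup>2 / (2 * s) \<le> (ln M)\<^sup>2 / (2 * K)"
      using l s assms(1) by (intro frac_le) auto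
    moreover have "(2 * w * l + l\<^sup>2) / (2 * s) = w * l / s + l\<^sup>2 / (2 * s)"
      by (simp add: add_divide_distrib)
    ultimately show ?thesis by linarith
  qed
  then have "exp (sqrt ((w + l)\<^sup>2 + K\<^sup>2) / 2) \<le> exp ((s + w * l / s + (ln M)\<^sup>2 / (2 * K)) / 2)"
    by simp
  also have "\<dots> = exp (s / 2) * exp (w * l / (2 * s)) * exp ((ln M)\<^sup>2 / (4 * K))"
    by (simp add: add_divide_distrib mult.commute flip: exp_add)
  finally have "potential K (a * x) (b * y) \<le>
      sqrt (a * x * (b * y)) * (exp (s / 2) * exp (w * l / (2 * s)) * exp ((ln M)\<^sup>2 / (4 * K)))"
    unfolding potential_def ln using assms by (intro mult_left_mono) auto
  also have "sqrt (a * x * (b * y)) = sqrt (a * b) * sqrt (x * y)"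
    by (simp add: real_sqrt_mult ac_simps)
  also have "sqrt (a * b) * sqrt (x * y) * (exp (s / 2) * exp (w * l / (2 * s)) * exp ((ln M)\<^sup>2 / (4 * K))) =
      potential K a b * (sqrt (x * y) * exp (w * l / (2 * s))) * exp ((ln M)\<^sup>2 / (4 * K))"
    by (simp add: potential_def s_def w_def ac_simps)
  also have "sqrt (x * y) * exp (w * l / (2 * s)) = x powr tilt K a b * y powr (1 - tilt K a b)"
  proof -
    have "sqrt (x * y) = exp (ln (x * y) / 2)"
      using assms by (simp add: ln_sqrt[symmetric])
    then have "sqrt (x * y) = exp ((ln x + ln y) / 2)"
      using assms by (simp add: ln_mult)
    then have "sqrt (x * y) * exp (w * l / (2 * s)) = exp ((ln x + ln y) / 2 + w * (ln x - ln y) / (2 * s))"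
      using assms by (simp add: l_def ln_div exp_add)
    also have "(ln x + ln y) / 2 + w * (ln x - ln y) / (2 * s) = tilt K a b * ln x + (1 - tilt K a b) * ln y"
      by (simp add: tilt_def s_def w_def algebra_simps add_divide_distrib diff_divide_distrib)
    finally show ?thesis
      using assms by (simp add: powr_def exp_add)
  qed
  finally show ?thesis .
qed

text \<open>Convexity of \<open>x powr s\<close> as a function of the exponent.\<close>

lemma powr_le_interpolate:
  fixes x :: real
  assumes "x \<ge> 0" "p \<le> s" "s \<le> q" "p < q"
  shows "x powr s \<le> (q - s) / (q - p) * x powr p + (s - p) / (q - p) * x powr q"
proof (cases "x = 0")
  case False
  define t where "t = (s - p) / (q - p)"
  have "t * (q - p) = s - p"
    using assms by (simp add: t_def)
  then have t: "0 \<le> t" "t \<le> 1" "(q - s) / (q - p) = 1 - t" "s = (1 - t) * p + t * q"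
    using assms by (simp_all add: t_def diff_divide_distrib[symmetric] divide_simps) (simp_all add: algebra_simps)
  \<comment> \<open>Tangent lines of the exponential at the intermediate exponent \<open>s\<close>;
    in the convex combination their linear terms cancel.\<close>
  have "1 + (p - s) * ln x \<le> x powr (p - s)" "1 + (q - s) * ln x \<le> x powr (q - s)"
    using False exp_ge_add_one_self by (simp_all add: powr_def)
  then have "(1 - t) * (1 + (p - s) * ln x) + t * (1 + (q - s) * ln x)
      \<le> (1 - t) * x powr (p - s) + t * x powr (q - s)"
    using t by (intro add_mono mult_left_mono) auto
  moreover have "(1 - t) * (1 + (p - s) * ln x) + t * (1 + (q - s) * ln x) = 1 + ((1 - t) * p + t * q - s) * ln x"
    by (simp add: algebra_simps)
  ultimately have "1 \<le> (1 - t) * x powr (p - s) + t * x powr (q - s)"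
    using t(4) by simp
  then have "x powr s * 1 \<le> x powr s * ((1 - t) * x powr (p - s) + t * x powr (q - s))"
    by (rule mult_left_mono) simp
  also have "\<dots> = (1 - t) * x powr p + t * x powr q"
    by (simp add: algebra_simps flip: powr_add)
  finally show ?thesis
    using t(3) by (simp add: t_def)
qed simp

text \<open>Reduces an estimate with a rational exponent to a comparison of integer powers, which
  can be evaluated exactly.\<close>

lemma powr_le_of_power_le:
  fixes x q :: real
  assumes "x \<ge> 0" "q \<ge> 0" "n > 0" "x ^ m \<le> q ^ n"
  shows "x powr (real m / real n) \<le> q"
proof (cases "x = 0")
  case False
  have "(x powr (real m / real n)) ^ n = x ^ m"
    using False assms by (simp add: powr_powr flip: powr_realpow)
  then show ?thesis
    using assms by (metis power_mono_iff powr_ge_zero)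
qed (use assms in simp)

section \<open>Numerical estimates\<close>

text \<open>The bases are row and column degrees of the pieces used below. The exponents are
  \<open>t\<close> or \<open>1 - t\<close> at the ends \<open>1 / 2\<close> and
  \<open>7 / 13\<close> of the near range.\<close>

lemma powr_numeral_bounds:
  "343 powr (1 / 2) \<le> (18.52026::real)" "316 powr (1 / 2) \<le> (17.77639::real)"
  "129 powr (1 / 2) \<le> (11.35782::real)" "84 powr (1 / 2) \<le> (9.16516::real)"
  "22 powr (1 / 2) \<le> (4.69042::real)" "7 powr (1 / 2) \<le> (2.64576::real)"
  "27 powr (1 / 2) \<le> (5.19616::real)" "8 powr (1 / 2) \<le> (2.82843::real)"
  "16 powr (1 / 2) \<le> (4::real)" "15 powr (1 / 2) \<le> (3.873::real)"
  "343 powr (6 / 13) \<le> (14.798::real)" "316 powr (7 / 13) \<le> (22.183::real)"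
  "129 powr (6 / 13) \<le> (9.423::real)" "84 powr (7 / 13) \<le> (10.869::real)"
  "22 powr (6 / 13) \<le> (4.166::real)" "7 powr (7 / 13) \<le> (2.852::real)"
  "27 powr (6 / 13) \<le> (4.578::real)" "8 powr (7 / 13) \<le> (3.065::real)"
  "16 powr (6 / 13) \<le> (3.5955::real)" "15 powr (7 / 13) \<le> (4.3::real)"
  "2 powr (6 / 13) \<le> (1.3771::real)" "3 powr (6 / 13) \<le> (1.661::real)" "7 powr (6 / 13) \<le> (2.456::real)"
  using powr_le_of_power_le[of 343 "18.52026" 2 1] powr_le_of_power_le[of 316 "17.77639" 2 1]
    powr_le_of_power_le[of 129 "11.35782" 2 1] powr_le_of_power_le[of 84 "9.16516" 2 1]
    powr_le_of_power_le[of 22 "4.69042" 2 1] powr_le_of_power_le[of 7 "2.64576" 2 1]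
    powr_le_of_power_le[of 27 "5.19616" 2 1] powr_le_of_power_le[of 8 "2.82843" 2 1]
    powr_le_of_power_le[of 16 "4" 2 1] powr_le_of_power_le[of 15 "3.873" 2 1]
    powr_le_of_power_le[of 343 "14.798" 13 6] powr_le_of_power_le[of 316 "22.183" 13 7]
    powr_le_of_power_le[of 129 "9.423" 13 6] powr_le_of_power_le[of 84 "10.869" 13 7]
    powr_le_of_power_le[of 22 "4.166" 13 6] powr_le_of_power_le[of 7 "2.852" 13 7]
    powr_le_of_power_le[of 27 "4.578" 13 6] powr_le_of_power_le[of 8 "3.065" 13 7]
    powr_le_of_power_le[of 16 "3.5955" 13 6] powr_le_of_power_le[of 15 "4.3" 13 7]
    powr_le_of_power_le[of 2 "1.3771" 13 6] powr_le_of_power_le[of 3 "1.661" 13 6]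
    powr_le_of_power_le[of 7 "2.456" 13 6]
  by (simp_all add: power_divide)

text \<open>By convexity it suffices to check the two ends of the range of exponents.\<close>

lemma tilted_bounds_near_half:
  fixes t :: real
  assumes "1 / 2 \<le> t" "t \<le> 7 / 13"
  shows "64 * (343 powr (1 - t) + 316 powr t) + 288 * (129 powr (1 - t) + 84 powr t) +
      192 * (22 powr (1 - t) + 7 powr t) + 432 * (27 powr (1 - t) + 8 powr t) + 792 \<le> (13903 :: real)"
    and "16 powr (1 - t) + 15 powr t \<le> (7.8965 :: real)"
proof -
  \<comment> \<open>The interval has length \<open>1 / 26\<close>, so \<open>u\<close> runs affinely
    from 0 to 1 over it.\<close>
  define u where "u = 26 * (t - 1 / 2)"
  have u: "0 \<le> u" "u \<le> 1"
    using assms by (auto simp: u_def)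
  have cols: "x powr t \<le> r - u * (r - r')" if "x powr (1 / 2) \<le> r" "x powr (7 / 13) \<le> r'" "x \<ge> 0" for x r r'
  proof -
    have "x powr t \<le> (1 - u) * x powr (1 / 2) + u * x powr (7 / 13)"
      using powr_le_interpolate[of x "1 / 2" t "7 / 13"] that assms by (simp add: u_def field_simps)
    also have "\<dots> \<le> (1 - u) * r + u * r'"
      using that u by (intro add_mono mult_left_mono) auto
    finally show ?thesis by (simp add: algebra_simps)
  qed
  have rows: "x powr (1 - t) \<le> r - u * (r - r')" if "x powr (1 / 2) \<le> r" "x powr (6 / 13) \<le> r'" "x \<ge> 0" for x r r'
  proof -
    have "x powr (1 - t) \<le> (1 - u) * x powr (1 / 2) + u * x powr (6 / 13)"
      using powr_le_interpolate[of x "6 / 13" "1 - t" "1 / 2"] that assms by (simp add: u_def field_simps)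
    also have "\<dots> \<le> (1 - u) * r + u * r'"
      using that u by (intro add_mono mult_left_mono) auto
    finally show ?thesis by (simp add: algebra_simps)
  qed
  note b = powr_numeral_bounds
  \<comment> \<open>With the powers replaced by variables under their chords, the claim is linear in
    \<open>u\<close>.\<close>
  have "64 * (x1 + x2) + 288 * (x3 + x4) + 192 * (x5 + x6) + 432 * (x7 + x8) + 792 \<le> 13903"
    if "x1 \<le> 18.52026 - u * (18.52026 - 14.798)" "x2 \<le> 17.77639 - u * (17.77639 - 22.183)"
      "x3 \<le> 11.35782 - u * (11.35782 - 9.423)" "x4 \<le> 9.16516 - u * (9.16516 - 10.869)"
      "x5 \<le> 4.69042 - u * (4.69042 - 4.166)" "x6 \<le> 2.64576 - u * (2.64576 - 2.852)"
      "x7 \<le> 5.19616 - u * (5.19616 - 4.578)" "x8 \<le> 2.82843 - u * (2.82843 - 3.065)"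
    for x1 x2 x3 x4 x5 x6 x7 x8
    using that u by (simp add: field_simps)
  from this[OF rows[OF b(1,11)] cols[OF b(2,12)] rows[OF b(3,13)] cols[OF b(4,14)]
      rows[OF b(5,15)] cols[OF b(6,16)] rows[OF b(7,17)] cols[OF b(8,18)]]
  show "64 * (343 powr (1 - t) + 316 powr t) + 288 * (129 powr (1 - t) + 84 powr t) +
      192 * (22 powr (1 - t) + 7 powr t) + 432 * (27 powr (1 - t) + 8 powr t) + 792 \<le> (13903 :: real)"
    by simp
  have "x1 + x2 \<le> 7.8965" if "x1 \<le> 4 - u * (4 - 3.5955)" "x2 \<le> 3.873 - u * (3.873 - 4.3)" for x1 x2
    using that u by (simp add: field_simps)
  from this[OF rows[OF b(9,19)] cols[OF b(10,20)]]
  show "16 powr (1 - t) + 15 powr t \<le> (7.8965 :: real)"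
    by simp
qed

text \<open>Here \<open>1 - t\<close> is at most \<open>6 / 13\<close>, and the powers, with bases
  at least 1, increase with the exponent, so that endpoint decides. The first sum is
  \<open>(1 + z) ^ 4\<close> with \<open>z = 2 powr (1 - t)\<close>, reflecting the fourfold
  Kronecker power.\<close>

lemma tilted_bounds_far:
  fixes t :: real
  assumes "7 / 13 \<le> t"
  shows "16 powr (1 - t) + 4 * 8 powr (1 - t) + 6 * 4 powr (1 - t) + 4 * 2 powr (1 - t) + 1 \<le> (31.935 :: real)"
    and "4 * 7 powr (1 - t) + 6 * 3 powr (1 - t) + 4 \<le> (23.8 :: real)"
proof -
  have le: "x powr (1 - t) \<le> r" if "x powr (6 / 13) \<le> r" "x \<ge> 1" for x r :: real
    using powr_mono[of "1 - t" "6 / 13" x] that assms by linarith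
  define z :: real where "z = 2 powr (1 - t)"
  have z: "0 \<le> z" "z \<le> 1.3771"
    using le[OF powr_numeral_bounds(21)] by (auto simp: z_def)
  have "2 powr (real n * (1 - t)) = z ^ n" for n
    by (simp add: z_def powr_powr mult.commute flip: powr_realpow)
  from this[of 4] this[of 3] this[of 2] have "16 powr (1 - t) = z ^ 4" "8 powr (1 - t) = z ^ 3" "4 powr (1 - t) = z ^ 2"
    using powr_powr[of 2 4 "1 - t"] powr_powr[of 2 3 "1 - t"] powr_powr[of 2 2 "1 - t"] by (simp_all add: powr_numeral)
  then have "16 powr (1 - t) + 4 * 8 powr (1 - t) + 6 * 4 powr (1 - t) + 4 * 2 powr (1 - t) + 1 = (1 + z) ^ 4"
    by (simp add: z_def[symmetric] algebra_simps power4_eq_xxxx power3_eq_cube power2_eq_square)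
  also have "\<dots> \<le> (1 + 1.3771) ^ 4"
    using z by (intro power_mono) auto
  finally show "16 powr (1 - t) + 4 * 8 powr (1 - t) + 6 * 4 powr (1 - t) + 4 * 2 powr (1 - t) + 1 \<le> (31.935 :: real)"
    by (simp add: power_divide)
  show "4 * 7 powr (1 - t) + 6 * 3 powr (1 - t) + 4 \<le> (23.8 :: real)"
    using le[OF powr_numeral_bounds(22)] le[OF powr_numeral_bounds(23)] by simp
qed

section \<open>The four-element block and its core\<close>

text \<open>Indices below \<open>16\<close> are read as four-bit masks of subsets, indices below \<open>4096\<close> as triples of masks.\<close>

definition bit_disjoint :: "nat \<Rightarrow> nat \<Rightarrow> bool" where
  "bit_disjoint i j \<longleftrightarrow>
     \<not> (i div 8 = 1 \<and> j div 8 = 1) \<and> \<not> (i mod 8 div 4 = 1 \<and> j mod 8 div 4 = 1) \<and>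
     \<not> (i mod 4 div 2 = 1 \<and> j mod 4 div 2 = 1) \<and> \<not> (i mod 2 = 1 \<and> j mod 2 = 1)"

definition weight :: "nat \<Rightarrow> nat" where
  "weight i = i div 8 + i mod 8 div 4 + i mod 4 div 2 + i mod 2"

definition core_mat :: "'a::semiring_1 mat" where
  "core_mat = mat 16 16 (\<lambda>(i, j). if i = 0 \<or> j = 0 then 0 else disjointness_mat 4 $$ (i, j))"

definition core_related :: "nat \<Rightarrow> nat \<Rightarrow> bool" where
  "core_related i j \<longleftrightarrow> i \<noteq> 0 \<and> j \<noteq> 0 \<and> bit_disjoint i j"

section \<open>Symmetry, support and row degrees of the block and its core\<close>

lemma dim_disjointness_mat [simp]:
  "dim_row (disjointness_mat k) = 2 ^ k" "dim_col (disjointness_mat k) = 2 ^ k"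
  by (simp_all add: disjointness_mat_def mat_of_rows_list_def numeral_2_eq_2)

lemma dim_core_mat [simp]: "dim_row core_mat = 16" "dim_col core_mat = 16"
  by (simp_all add: core_mat_def)

lemma transpose_disjointness_mat:
  "transpose_mat (disjointness_mat k) = (disjointness_mat k :: 'a::semiring_1 mat)"
  unfolding disjointness_mat_def
proof (rule transpose_kronecker_power)
  show "transpose_mat (mat_of_rows_list 2 [[1, 1], [1, 0]]) = (mat_of_rows_list 2 [[1, 1], [1, 0]] :: 'a mat)"
    by (rule eq_matI) (auto simp: mat_of_rows_list_def less_Suc_eq numeral_2_eq_2)
qed

lemma transpose_core_mat: "transpose_mat core_mat = (core_mat :: 'a::semiring_1 mat)"
proof (rule eq_matI)
  fix i j assume "i < dim_row (core_mat :: 'a mat)" "j < dim_col (core_mat :: 'a mat)"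
  moreover from this have "disjointness_mat 4 $$ (j, i) = (disjointness_mat 4 $$ (i, j) :: 'a)"
    using arg_cong[OF transpose_disjointness_mat[of 4, where 'a = 'a], of "\<lambda>A. A $$ (i, j)"] by simp
  ultimately show "transpose_mat core_mat $$ (i, j) = (core_mat $$ (i, j) :: 'a)"
    by (auto simp: core_mat_def)
qed auto

text \<open>A nonzero product has four nonzero digit factors. This implication is what degree bounds
  from above require.\<close>

lemma disjointness_mat_4_nonzero:
  assumes "disjointness_mat 4 $$ (i, j) \<noteq> (0 :: 'a::semiring_1)" "i < 16" "j < 16"
  shows "bit_disjoint i j"
proof -
  let ?A = "mat_of_rows_list 2 [[1, 1], [1, 0]] :: 'a mat"
  have [simp]: "dim_row ?A = 2" "dim_col ?A = 2"
    by (simp_all add: mat_of_rows_list_def)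
  have A: "\<not> (a = 1 \<and> b = 1)" if "?A $$ (a, b) \<noteq> 0" for a b
    using that by (auto simp: mat_of_rows_list_def)
  have "kronecker_power ?A 4 = kronecker ?A (kronecker ?A (kronecker ?A (kronecker ?A (1\<^sub>m 1))))"
    by (simp add: numeral_eq_Suc)
  then have "disjointness_mat 4 $$ (i, j) = ?A $$ (i div 8, j div 8) * (?A $$ (i mod 8 div 4, j mod 8 div 4) *
      (?A $$ (i mod 8 mod 4 div 2, j mod 8 mod 4 div 2) * ?A $$ (i mod 8 mod 4 mod 2, j mod 8 mod 4 mod 2)))"
    using assms(2,3) by (simp add: disjointness_mat_def)
  moreover have "k mod 8 mod 4 = k mod 4" "k mod 8 mod 4 mod 2 = k mod 2" for k :: nat
    by (simp_all add: mod_mod_cancel)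
  ultimately have "?A $$ (i div 8, j div 8) \<noteq> 0" "?A $$ (i mod 8 div 4, j mod 8 div 4) \<noteq> 0"
    "?A $$ (i mod 4 div 2, j mod 4 div 2) \<noteq> 0" "?A $$ (i mod 2, j mod 2) \<noteq> 0"
    using assms(1) by auto
  then show ?thesis
    unfolding bit_disjoint_def by (intro conjI A)
qed

lemma core_mat_nonzero:
  "core_mat $$ (i, j) \<noteq> (0 :: 'a::semiring_1) \<Longrightarrow> i < 16 \<Longrightarrow> j < 16 \<Longrightarrow> core_related i j"
  using disjointness_mat_4_nonzero[of i j, where 'a = 'a]
  by (auto simp: core_mat_def core_related_def split: if_splits)

lemma core_related_commute: "core_related i j \<longleftrightarrow> core_related j i"
  by (auto simp: core_related_def bit_disjoint_def)

text \<open>Sums a function of the weight over the subsets disjoint from a given one of weight \<open>w\<close>; both sets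
  have to be nonempty, so the weights \<open>0\<close> and \<open>4\<close> contribute nothing.\<close>

definition sum_core_neighbours :: "nat \<Rightarrow> (nat \<Rightarrow> nat) \<Rightarrow> nat" where
  "sum_core_neighbours w h =
     (if w = 1 then 3 * h 1 + 3 * h 2 + h 3 else if w = 2 then 2 * h 1 + h 2 else if w = 3 then h 1 else 0)"

lemma less_16_cases:
  assumes "(i::nat) < 16"
  obtains "i = 0" | "i = 1" | "i = 2" | "i = 3" | "i = 4" | "i = 5" | "i = 6" | "i = 7" | "i = 8"
    | "i = 9" | "i = 10" | "i = 11" | "i = 12" | "i = 13" | "i = 14" | "i = 15"
  using assms by (auto simp: numeral_eq_Suc less_Suc_eq)

text \<open>Permuting the four elements shows that the neighbours of a set are distributed over the
  weights according to its size alone; here this is checked mask by mask.\<close>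

lemma sum_core_related:
  assumes "i < 16"
  shows "(\<Sum>j<16. if core_related i j then h (weight j) else 0) = sum_core_neighbours (weight i) h"
  using assms
  by (cases i rule: less_16_cases)
    (simp_all add: lessThan_nat_numeral core_related_def bit_disjoint_def weight_def sum_core_neighbours_def
      flip: numeral_2_eq_2)

lemma sum_weight:
  fixes F :: "nat \<Rightarrow> real"
  shows "(\<Sum>i<16. F (weight i)) = F 0 + 4 * F 1 + 6 * F 2 + 4 * F 3 + F 4"
  by (simp add: lessThan_nat_numeral weight_def algebra_simps flip: numeral_2_eq_2)

text \<open>The sets disjoint from \<open>i\<close> are the subsets of its complement, which has
  \<open>4 - weight i\<close> elements.\<close>

lemma card_disjointness_mat_4_row:
  assumes "i < 16"
  shows "card {j. j < 16 \<and> disjointness_mat 4 $$ (i, j) \<noteq> (0 :: 'a::semiring_1)} \<le> 2 ^ (4 - weight i)"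
proof -
  have "card {j. j < 16 \<and> disjointness_mat 4 $$ (i, j) \<noteq> (0 :: 'a)} \<le> card {j \<in> {..<16}. bit_disjoint i j}"
    using assms disjointness_mat_4_nonzero by (intro card_mono) auto
  also have "\<dots> = (\<Sum>j<16. if bit_disjoint i j then 1 else 0)"
    by (simp add: sum.If_cases Int_def)
  also have "\<dots> = 2 ^ (4 - weight i)"
    using assms
    by (cases i rule: less_16_cases)
      (simp_all add: lessThan_nat_numeral bit_disjoint_def weight_def)
  finally show ?thesis .
qed

lemma card_core_mat_row:
  assumes "i < 16"
  shows "card {j. j < 16 \<and> core_mat $$ (i, j) \<noteq> (0 :: 'a::semiring_1)} \<le> sum_core_neighbours (weight i) (\<lambda>_. 1)"
proof -
  have "card {j. j < 16 \<and> core_mat $$ (i, j) \<noteq> (0 :: 'a)} \<le> card {j \<in> {..<16}. core_related i j}"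
    using assms core_mat_nonzero by (intro card_mono) auto
  also have "\<dots> = (\<Sum>j<16. if core_related i j then 1 else 0)"
    by (simp add: sum.If_cases Int_def)
  also have "\<dots> = sum_core_neighbours (weight i) (\<lambda>_. 1)"
    by (rule sum_core_related[OF assms])
  finally show ?thesis .
qed

section \<open>Degrees in the Kronecker cube of the core\<close>

definition cube_weight :: "nat \<Rightarrow> nat" where
  "cube_weight i = weight (i div 256) + weight (i mod 256 div 16) + weight (i mod 256 mod 16)"

text \<open>Counting by component weights instead of by masks keeps the evaluation of degrees small:
  no search through 4096 columns is needed.\<close>

definition cube_degree :: "(nat \<Rightarrow> nat \<Rightarrow> bool) \<Rightarrow> nat \<Rightarrow> nat \<Rightarrow> nat \<Rightarrow> nat" where
  "cube_degree P u v w = sum_core_neighbours u (\<lambda>u'. sum_core_neighbours v (\<lambda>v'.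
     sum_core_neighbours w (\<lambda>w'. if P (u + v + w) (u' + v' + w') then 1 else 0)))"

definition core_cube_related :: "nat \<Rightarrow> nat \<Rightarrow> bool" where
  "core_cube_related i j \<longleftrightarrow> core_related (i div 256) (j div 256) \<and>
     core_related (i mod 256 div 16) (j mod 256 div 16) \<and> core_related (i mod 256 mod 16) (j mod 256 mod 16)"

lemma core_cube_related_commute: "core_cube_related i j \<longleftrightarrow> core_cube_related j i"
  using core_related_commute by (simp add: core_cube_related_def)

lemma core_cube_nonzero:
  assumes "kronecker_power core_mat 3 $$ (i, j) \<noteq> (0 :: 'a::semiring_1)" "i < 4096" "j < 4096"
  shows "core_cube_related i j"
proof -
  have "kronecker_power core_mat 3 = kronecker core_mat (kronecker core_mat (kronecker core_mat (1\<^sub>m 1 :: 'a mat)))"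
    by (simp add: numeral_eq_Suc)
  then have "core_mat $$ (i div 256, j div 256) * (core_mat $$ (i mod 256 div 16, j mod 256 div 16) *
      core_mat $$ (i mod 256 mod 16, j mod 256 mod 16)) \<noteq> (0 :: 'a)"
    using assms by simp
  then have "core_mat $$ (i div 256, j div 256) \<noteq> (0 :: 'a)"
    "core_mat $$ (i mod 256 div 16, j mod 256 div 16) \<noteq> (0 :: 'a)"
    "core_mat $$ (i mod 256 mod 16, j mod 256 mod 16) \<noteq> (0 :: 'a)"
    by auto
  then show ?thesis
    using assms(2,3) core_mat_nonzero by (auto simp: core_cube_related_def intro!: core_mat_nonzero)
qed

lemma sum_cube:
  fixes F :: "nat \<Rightarrow> nat \<Rightarrow> nat \<Rightarrow> 'b::comm_monoid_add"
  shows "(\<Sum>j<4096. F (j div 256) (j mod 256 div 16) (j mod 256 mod 16)) = (\<Sum>x<16. \<Sum>y<16. \<Sum>z<16. F x y z)"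
proof -
  have "(\<Sum>y<256. F x (y div 16) (y mod 16)) = (\<Sum>y<16. \<Sum>z<16. F x y z)" for x
    using sum_div_mod[of "F x" 16 16] by simp
  then show ?thesis
    using sum_div_mod[where f = "\<lambda>x y. F x (y div 16) (y mod 16)" and m = 16 and n = 256] by simp
qed

lemma card_core_cube_related:
  assumes "i < 4096"
  shows "card {j. j < 4096 \<and> core_cube_related i j \<and> P (cube_weight i) (cube_weight j)} =
    cube_degree P (weight (i div 256)) (weight (i mod 256 div 16)) (weight (i mod 256 mod 16))"
proof -
  let ?x = "i div 256" and ?y = "i mod 256 div 16" and ?z = "i mod 256 mod 16"
  have "{j. j < 4096 \<and> core_cube_related i j \<and> P (cube_weight i) (cube_weight j)} =
      {j \<in> {..<4096}. core_cube_related i j \<and> P (cube_weight i) (cube_weight j)}"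
    by auto
  then have "card {j. j < 4096 \<and> core_cube_related i j \<and> P (cube_weight i) (cube_weight j)} =
      (\<Sum>j<4096. if core_cube_related i j \<and> P (cube_weight i) (cube_weight j) then 1 else 0)"
    by (simp add: sum.If_cases Int_def)
  also have "\<dots> = (\<Sum>x<16. \<Sum>y<16. \<Sum>z<16. if core_related ?x x then if core_related ?y y then if core_related ?z z then
      if P (cube_weight i) (weight x + weight y + weight z) then 1 else 0 else 0 else 0 else 0)"
    by (subst sum_cube[symmetric], rule sum.cong) (auto simp: core_cube_related_def cube_weight_def)
  also have "\<dots> = (\<Sum>x<16. if core_related ?x x then \<Sum>y<16. if core_related ?y y then \<Sum>z<16. if core_related ?z z then
      if P (cube_weight i) (weight x + weight y + weight z) then 1 else 0 else 0 else 0 else 0)"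
    by (intro sum.cong refl) (auto intro!: sum.cong)
  also have "\<dots> = cube_degree P (weight ?x) (weight ?y) (weight ?z)"
  proof -
    have lt: "?x < 16" "?y < 16" "?z < 16"
      using assms by auto
    \<comment> \<open>The three sums collapse from the innermost outwards; each summand depends on
      its mask only through the weight.\<close>
    note z = sum_core_related[OF lt(3), where h = "\<lambda>w'. if P c (u + v + w') then 1 else 0" for c u v]
      and y = sum_core_related[OF lt(2), where h = "\<lambda>v'. sum_core_neighbours w
        (\<lambda>w'. if P c (u + v' + w') then 1 else 0)" for c u w]
      and x = sum_core_related[OF lt(1), where h = "\<lambda>u'. sum_core_neighbours v
        (\<lambda>v'. sum_core_neighbours w (\<lambda>w'. if P c (u' + v' + w') then 1 else 0))" for c v w]
    show ?thesis
      unfolding x y z cube_degree_def cube_weight_def ..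
  qed
  finally show ?thesis .
qed

lemma sum_cube_weight:
  fixes F :: "nat \<Rightarrow> nat \<Rightarrow> nat \<Rightarrow> real"
  defines "S \<equiv> \<lambda>f. f 0 + 4 * f 1 + 6 * f 2 + 4 * f 3 + f 4"
  shows "(\<Sum>i<4096. F (weight (i div 256)) (weight (i mod 256 div 16)) (weight (i mod 256 mod 16))) =
    S (\<lambda>u. S (\<lambda>v. S (\<lambda>w. F u v w)))"
  unfolding sum_cube[where F = "\<lambda>x y z. F (weight x) (weight y) (weight z)"]
  using sum_weight[where F = "\<lambda>u. S (\<lambda>v. S (\<lambda>w. F u v w))"]
    sum_weight[where F = "\<lambda>v. S (\<lambda>w. F u v w)" for u] sum_weight[where F = "F u v" for u v]
  by (simp add: S_def)

text \<open>Triples are grouped by component sizes: 64 have sizes 1,1,1, while 288 have 1,1,2, 192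
  have 1,1,3 and 432 have 1,2,2 in some order. The 792 triples of sizes 1,2,3 in some order or 2,2,2
  have one neighbour of equal total size and none larger. All others have degree zero and vanish by
  \<open>g 0 = 0\<close>.\<close>

lemma sum_cube_degree:
  fixes g :: "nat \<Rightarrow> real"
  assumes "g 0 = 0"
  shows "(\<Sum>i<4096. g (cube_degree (\<le>) (weight (i div 256)) (weight (i mod 256 div 16)) (weight (i mod 256 mod 16)))) =
      64 * g 343 + 288 * g 129 + 192 * g 22 + 432 * g 27 + 792 * g 1"
    and "(\<Sum>i<4096. g (cube_degree (<) (weight (i div 256)) (weight (i mod 256 div 16)) (weight (i mod 256 mod 16)))) =
      64 * g 316 + 288 * g 84 + 192 * g 7 + 432 * g 8"
  unfolding sum_cube_weight[where F = "\<lambda>u v w. g (cube_degree (\<le>) u v w)"]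
    sum_cube_weight[where F = "\<lambda>u v w. g (cube_degree (<) u v w)"]
  by (simp_all add: assms cube_degree_def sum_core_neighbours_def)

section \<open>One step of the decomposition\<close>

text \<open>\<open>potential_step\<close> is applied to each row with the factors 1 and
  \<open>d i\<close>.\<close>

lemma sum_potential_rows_le:
  fixes d :: "nat \<Rightarrow> nat"
  assumes "K > 0" "a > 0" "b > 0" "G \<ge> 0" and d: "\<And>i. i < m \<Longrightarrow> d i \<le> M" and "M \<ge> 1"
  shows "(\<Sum>i | i < m \<and> d i > 0. G * potential K a (b * real (d i))) \<le>
    G * potential K a b * (\<Sum>i<m. real (d i) powr (1 - tilt K a b)) * exp ((ln (real M))\<^sup>2 / (4 * K))"
proof -
  let ?E = "exp ((ln (real M))\<^sup>2 / (4 * K))"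
  have "(\<Sum>i | i < m \<and> d i > 0. G * potential K a (b * real (d i))) \<le>
      (\<Sum>i | i < m \<and> d i > 0. G * potential K a b * real (d i) powr (1 - tilt K a b) * ?E)"
  proof (rule sum_mono)
    fix i assume "i \<in> {i. i < m \<and> d i > 0}"
    then have "1 \<le> real (d i)" "real (d i) \<le> real M"
      using d[of i] by auto
    then have "potential K (a * 1) (b * real (d i)) \<le>
        potential K a b * (1 powr tilt K a b * real (d i) powr (1 - tilt K a b)) * ?E"
      using assms by (intro potential_step) auto
    from mult_left_mono[OF this assms(4)]
    show "G * potential K a (b * real (d i)) \<le> G * potential K a b * real (d i) powr (1 - tilt K a b) * ?E"
      by (simp add: mult.assoc)
  qed
  \<comment> \<open>Empty rows may be included again because \<open>0 powr\<close> any exponent is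
    0.\<close>
  also have "\<dots> = (\<Sum>i<m. G * potential K a b * real (d i) powr (1 - tilt K a b) * ?E)"
    by (rule sum.mono_neutral_left) auto
  finally show ?thesis
    by (simp add: sum_distrib_left sum_distrib_right)
qed

lemma sum_potential_cols_le:
  fixes e :: "nat \<Rightarrow> nat"
  assumes "K > 0" "a > 0" "b > 0" "G \<ge> 0" and e: "\<And>j. j < n \<Longrightarrow> e j \<le> M" and "M \<ge> 1"
  shows "(\<Sum>j | j < n \<and> e j > 0. G * potential K (a * real (e j)) b) \<le>
    G * potential K a b * (\<Sum>j<n. real (e j) powr tilt K a b) * exp ((ln (real M))\<^sup>2 / (4 * K))"
proof -
  let ?E = "exp ((ln (real M))\<^sup>2 / (4 * K))"
  have "(\<Sum>j | j < n \<and> e j > 0. G * potential K (a * real (e j)) b) \<le>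
      (\<Sum>j | j < n \<and> e j > 0. G * potential K a b * real (e j) powr tilt K a b * ?E)"
  proof (rule sum_mono)
    fix j assume "j \<in> {j. j < n \<and> e j > 0}"
    then have "1 \<le> real (e j)" "real (e j) \<le> real M"
      using e[of j] by auto
    then have "potential K (a * real (e j)) (b * 1) \<le>
        potential K a b * (real (e j) powr tilt K a b * 1 powr (1 - tilt K a b)) * ?E"
      using assms by (intro potential_step) auto
    from mult_left_mono[OF this assms(4)]
    show "G * potential K (a * real (e j)) b \<le> G * potential K a b * real (e j) powr tilt K a b * ?E"
      by (simp add: mult.assoc)
  qed
  also have "\<dots> = (\<Sum>j<n. G * potential K a b * real (e j) powr tilt K a b * ?E)"
    by (rule sum.mono_neutral_left) auto
  finally show ?thesis
    by (simp add: sum_distrib_left sum_distrib_right)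
qed

text \<open>A matrix split as \<open>M\<^sub>1 + M\<^sub>2\<close> is the sum of the rows of \<open>M\<^sub>1\<close> and the columns of \<open>M\<^sub>2\<close>, all of
  which have rank one.\<close>

lemma cost_le_kronecker_rows_cols:
  fixes M\<^sub>1 M\<^sub>2 Z :: "'a::comm_semiring_1 mat"
  assumes M: "M\<^sub>1 \<in> carrier_mat m n" "M\<^sub>2 \<in> carrier_mat m n"
    and d: "\<And>i. i < m \<Longrightarrow> card {j. j < n \<and> M\<^sub>1 $$ (i, j) \<noteq> 0} \<le> d i" "\<And>i. i < m \<Longrightarrow> d i \<le> D"
    and e: "\<And>j. j < n \<Longrightarrow> card {i. i < m \<and> M\<^sub>2 $$ (i, j) \<noteq> 0} \<le> e j" "\<And>j. j < n \<Longrightarrow> e j \<le> D"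
    and Z: "\<And>x y. x > 0 \<Longrightarrow> y > 0 \<Longrightarrow> cost_le Z x y (G * potential K x y)"
    and pos: "K > 0" "a > 0" "b > 0" "G \<ge> 0" "D \<ge> 1"
  shows "cost_le (kronecker (M\<^sub>1 + M\<^sub>2) Z) a b
    (G * potential K a b * ((\<Sum>i<m. real (d i) powr (1 - tilt K a b)) + (\<Sum>j<n. real (e j) powr tilt K a b)) *
      exp ((ln (real D))\<^sup>2 / (4 * K)))"
proof -
  have "cost_le (kronecker M\<^sub>1 Z) a b (\<Sum>i | i < m \<and> d i > 0. G * potential K a (b * real (d i)))"
    using pos by (intro cost_le_kronecker_rows[OF M(1) d(1)] Z) auto
  then have rows: "cost_le (kronecker M\<^sub>1 Z) a b (G * potential K a b * (\<Sum>i<m. real (d i) powr (1 - tilt K a b)) *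
      exp ((ln (real D))\<^sup>2 / (4 * K)))"
    by (rule cost_le_mono) (intro sum_potential_rows_le pos d(2))
  have "cost_le (kronecker M\<^sub>2 Z) a b (\<Sum>j | j < n \<and> e j > 0. G * potential K (a * real (e j)) b)"
    using pos by (intro cost_le_kronecker_cols[OF M(2) e(1)] Z) auto
  then have cols: "cost_le (kronecker M\<^sub>2 Z) a b (G * potential K a b * (\<Sum>j<n. real (e j) powr tilt K a b) *
      exp ((ln (real D))\<^sup>2 / (4 * K)))"
    by (rule cost_le_mono) (intro sum_potential_cols_le pos e(2))
  have "cost_le (kronecker M\<^sub>1 Z + kronecker M\<^sub>2 Z) a b
    (G * potential K a b * (\<Sum>i<m. real (d i) powr (1 - tilt K a b)) * exp ((ln (real D))\<^sup>2 / (4 * K)) +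
     G * potential K a b * (\<Sum>j<n. real (e j) powr tilt K a b) * exp ((ln (real D))\<^sup>2 / (4 * K)))"
    using M pos by (intro cost_le_add rows cols) auto
  then show ?thesis
    using M by (simp add: kronecker_add_left distrib_left distrib_right)
qed

section \<open>The recursive cost bounds when the left weight is at least the right one\<close>

context
  fixes Z :: "'a::comm_semiring_1 mat" and G K a b :: real
  assumes Z: "\<And>x y. x > 0 \<Longrightarrow> y > 0 \<Longrightarrow> cost_le Z x y (G * potential K x y)"
    and ab: "a \<ge> b" "b > 0" and G: "G \<ge> 0" and K: "K > 0" "exp ((ln 343)\<^sup>2 / (4 * K)) = 1.0004"
begin

lemma GP_nonneg: "G * potential K a b \<ge> 0"
  using G ab potential_pos[of a b K] by simp

text \<open>Each entry goes to the row or column of the smaller triple, ties going to rows. The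
  resulting tilted sum, including the smoothing loss, is at most \<open>13903 * 1.0004\<close>, just
  below \<open>24.049 ^ 3\<close>.\<close>

lemma cost_le_core_cube:
  assumes "tilt K a b \<le> 7 / 13"
  shows "cost_le (kronecker (kronecker_power core_mat 3) Z) a b (24.049 ^ 3 * G * potential K a b)"
proof -
  let ?t = "tilt K a b" and ?X = "kronecker_power core_mat 3 :: 'a mat"
  define M\<^sub>1 where "M\<^sub>1 = mat 4096 4096 (\<lambda>(i, j). if cube_weight i \<le> cube_weight j then ?X $$ (i, j) else 0)"
  define M\<^sub>2 where "M\<^sub>2 = mat 4096 4096 (\<lambda>(i, j). if cube_weight j < cube_weight i then ?X $$ (i, j) else 0)"
  define deg where "deg P i = cube_degree P (weight (i div 256)) (weight (i mod 256 div 16)) (weight (i mod 256 mod 16))" for P i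
  have split: "?X = M\<^sub>1 + M\<^sub>2"
    by (rule eq_matI) (auto simp: M\<^sub>1_def M\<^sub>2_def)
  have deg: "card {j. j < 4096 \<and> core_cube_related i j \<and> P (cube_weight i) (cube_weight j)} = deg P i"
    if "i < 4096" for P i
    unfolding deg_def by (rule card_core_cube_related[OF that])
  \<comment> \<open>A core row has at most 7 entries, hence the bound \<open>7 ^ 3\<close>, to which
    the smoothing parameter is tuned.\<close>
  have bound: "deg P i \<le> 343" for P i
  proof -
    have le: "sum_core_neighbours w h \<le> 7 * c" if "\<And>x. h x \<le> c" for w h c
      using that[of 1] that[of 2] that[of 3] by (auto simp: sum_core_neighbours_def)
    have "deg P i \<le> 7 * (7 * (7 * 1))"
      unfolding deg_def cube_degree_def by (intro le) simp
    then show ?thesis by simp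
  qed
  have "cost_le (kronecker (M\<^sub>1 + M\<^sub>2) Z) a b
    (G * potential K a b * ((\<Sum>i<4096. real (deg (\<le>) i) powr (1 - ?t)) + (\<Sum>j<4096. real (deg (<) j) powr ?t)) *
      exp ((ln (real 343))\<^sup>2 / (4 * K)))"
  proof (rule cost_le_kronecker_rows_cols[OF _ _ _ bound _ bound Z])
    show "card {j. j < 4096 \<and> M\<^sub>1 $$ (i, j) \<noteq> 0} \<le> deg (\<le>) i" if "i < 4096" for i
      unfolding deg[OF that, symmetric] using that
      by (intro card_mono) (auto simp: M\<^sub>1_def dest!: core_cube_nonzero split: if_splits)
    show "card {i. i < 4096 \<and> M\<^sub>2 $$ (i, j) \<noteq> 0} \<le> deg (<) j" if "j < 4096" for j
      unfolding deg[OF that, symmetric] using that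
      by (intro card_mono) (auto simp: M\<^sub>2_def core_cube_related_commute[of j] dest!: core_cube_nonzero split: if_splits)
  qed (use ab G K in \<open>auto simp: M\<^sub>1_def M\<^sub>2_def\<close>)
  moreover have "(\<Sum>i<4096. real (deg (\<le>) i) powr (1 - ?t)) + (\<Sum>j<4096. real (deg (<) j) powr ?t) \<le> 13903"
    using sum_cube_degree(1)[where g = "\<lambda>x. real x powr (1 - ?t)"] sum_cube_degree(2)[where g = "\<lambda>x. real x powr ?t"]
      tilted_bounds_near_half(1)[OF tilt_bounds(1) assms] ab K
    unfolding deg_def by simp
  then have "G * potential K a b * ((\<Sum>i<4096. real (deg (\<le>) i) powr (1 - ?t)) + (\<Sum>j<4096. real (deg (<) j) powr ?t)) *
      exp ((ln (real 343))\<^sup>2 / (4 * K)) \<le> G * potential K a b * 13903 * 1.0004"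
    using GP_nonneg K(2) by (intro mult_mono mult_left_mono) (auto intro!: mult_nonneg_nonneg add_nonneg_nonneg sum_nonneg)
  moreover have "G * potential K a b * 13903 * 1.0004 \<le> 24.049 ^ 3 * G * potential K a b"
    using mult_right_mono[of "13903 * 1.0004" "24.049 ^ 3" "G * potential K a b"] GP_nonneg
    by (simp add: power_divide mult_ac)
  ultimately show ?thesis
    unfolding split using cost_le_mono order_trans by blast
qed

text \<open>A large tilt makes row entries cheap, so plain rows of a single core factor do. The
  added zero matrix is the empty column part, and the degree bound 343 is kept so that the loss is
  again \<open>1.0004\<close>.\<close>

lemma cost_le_core_far:
  assumes "tilt K a b \<ge> 7 / 13"
  shows "cost_le (kronecker core_mat Z) a b (24.049 * G * potential K a b)"
proof -
  let ?t = "tilt K a b"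
  let ?d = "\<lambda>i. sum_core_neighbours (weight i) (\<lambda>_. 1)"
  have "cost_le (kronecker (core_mat + 0\<^sub>m 16 16) Z) a b
    (G * potential K a b * ((\<Sum>i<16. real (?d i) powr (1 - ?t)) + (\<Sum>j<16::nat. real 0 powr ?t)) *
      exp ((ln (real 343))\<^sup>2 / (4 * K)))"
    by (rule cost_le_kronecker_rows_cols[where d = ?d and e = "\<lambda>_. 0", OF _ _ card_core_mat_row _ _ _ Z])
      (use ab G K in \<open>auto simp: sum_core_neighbours_def intro!: carrier_matI\<close>)
  moreover have "(\<Sum>i<16. real (?d i) powr (1 - ?t)) \<le> 23.8"
    using sum_weight[where F = "\<lambda>w. real (sum_core_neighbours w (\<lambda>_. 1)) powr (1 - ?t)"] tilted_bounds_far(2)[OF assms]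
    by (simp add: sum_core_neighbours_def)
  then have "G * potential K a b * ((\<Sum>i<16. real (?d i) powr (1 - ?t)) + (\<Sum>j<16::nat. real 0 powr ?t)) *
      exp ((ln (real 343))\<^sup>2 / (4 * K)) \<le> G * potential K a b * 23.8 * 1.0004"
    using GP_nonneg K(2) by (intro mult_mono mult_left_mono) (auto intro!: mult_nonneg_nonneg add_nonneg_nonneg sum_nonneg)
  moreover have "G * potential K a b * 23.8 * 1.0004 \<le> 24.049 * G * potential K a b"
    using mult_right_mono[of "23.8 * 1.0004" "24.049" "G * potential K a b"] GP_nonneg
    by (simp add: mult_ac)
  moreover have "core_mat + 0\<^sub>m 16 16 = (core_mat :: 'a mat)"
    by (rule right_add_zero_mat) (auto intro!: carrier_matI)
  ultimately show ?thesis
    using cost_le_mono order_trans by fastforce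
qed

lemma cost_le_block_far:
  assumes "tilt K a b \<ge> 7 / 13"
  shows "cost_le (kronecker (disjointness_mat 4) Z) a b (31.9488 * G * potential K a b)"
proof -
  let ?t = "tilt K a b"
  let ?d = "\<lambda>i. 2 ^ (4 - weight i) :: nat"
  have "?d i \<le> 343" for i
    using power_increasing[of "4 - weight i" 4 "2 :: nat"] by simp
  then have "cost_le (kronecker (disjointness_mat 4 + 0\<^sub>m 16 16) Z) a b
    (G * potential K a b * ((\<Sum>i<16. real (?d i) powr (1 - ?t)) + (\<Sum>j<16::nat. real 0 powr ?t)) *
      exp ((ln (real 343))\<^sup>2 / (4 * K)))"
    by (intro cost_le_kronecker_rows_cols[where d = ?d and e = "\<lambda>_. 0", OF _ _ card_disjointness_mat_4_row _ _ _ Z])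
      (use ab G K in \<open>auto intro!: carrier_matI\<close>)
  moreover have "(\<Sum>i<16. real (?d i) powr (1 - ?t)) \<le> 31.935"
    using sum_weight[where F = "\<lambda>w. real (2 ^ (4 - w)) powr (1 - ?t)"] tilted_bounds_far(1)[OF assms]
    by simp
  then have "G * potential K a b * ((\<Sum>i<16. real (?d i) powr (1 - ?t)) + (\<Sum>j<16::nat. real 0 powr ?t)) *
      exp ((ln (real 343))\<^sup>2 / (4 * K)) \<le> G * potential K a b * 31.935 * 1.0004"
    using GP_nonneg K(2) by (intro mult_mono mult_left_mono) (auto intro!: mult_nonneg_nonneg add_nonneg_nonneg sum_nonneg)
  moreover have "G * potential K a b * 31.935 * 1.0004 \<le> 31.9488 * G * potential K a b"
    using mult_right_mono[of "31.935 * 1.0004" "31.9488" "G * potential K a b"] GP_nonneg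
    by (simp add: mult_ac)
  moreover have "disjointness_mat 4 + 0\<^sub>m 16 16 = (disjointness_mat 4 :: 'a mat)"
    by (rule right_add_zero_mat) (auto intro!: carrier_matI)
  ultimately show ?thesis
    using cost_le_mono order_trans by fastforce
qed

text \<open>The row of the empty set has 16 entries and the rest of its column has 15. The core is
  not expanded here: its cost is a hypothesis, to be supplied by the induction, so that core factors
  can accumulate until three are available.\<close>

lemma cost_le_block_near:
  assumes "tilt K a b \<le> 7 / 13" and core: "cost_le (kronecker core_mat Z) a b (24.049 * G * potential K a b)"
  shows "cost_le (kronecker (disjointness_mat 4) Z) a b (31.9488 * G * potential K a b)"
proof -
  let ?t = "tilt K a b" and ?R = "disjointness_mat 4 :: 'a mat"
  define M\<^sub>1 where "M\<^sub>1 = mat 16 16 (\<lambda>(i, j). if i = 0 then ?R $$ (i, j) else 0)"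
  define M\<^sub>2 where "M\<^sub>2 = mat 16 16 (\<lambda>(i, j). if i \<noteq> 0 \<and> j = 0 then ?R $$ (i, j) else 0)"
  have split: "?R = (M\<^sub>1 + M\<^sub>2) + core_mat"
    by (rule eq_matI) (auto simp: M\<^sub>1_def M\<^sub>2_def core_mat_def)
  have "cost_le (kronecker (M\<^sub>1 + M\<^sub>2) Z) a b
    (G * potential K a b * ((\<Sum>i<16::nat. real (if i = 0 then 16 else 0) powr (1 - ?t)) +
      (\<Sum>j<16::nat. real (if j = 0 then 15 else 0) powr ?t)) * exp ((ln (real 343))\<^sup>2 / (4 * K)))"
  proof (rule cost_le_kronecker_rows_cols[where d = "\<lambda>i. if i = 0 then 16 else 0" and e = "\<lambda>j. if j = 0 then 15 else 0", OF _ _ _ _ _ _ Z])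
    show "card {j. j < 16 \<and> M\<^sub>1 $$ (i, j) \<noteq> 0} \<le> (if i = 0 then 16 else 0)" if "i < 16" for i
    proof -
      have "card {j. j < 16 \<and> M\<^sub>1 $$ (i, j) \<noteq> 0} \<le> card (if i = 0 then {..<16::nat} else {})"
        using that by (intro card_mono) (auto simp: M\<^sub>1_def)
      then show ?thesis by (simp split: if_splits)
    qed
    show "card {i. i < 16 \<and> M\<^sub>2 $$ (i, j) \<noteq> 0} \<le> (if j = 0 then 15 else 0)" if "j < 16" for j
    proof -
      have "card {i. i < 16 \<and> M\<^sub>2 $$ (i, j) \<noteq> 0} \<le> card (if j = 0 then {1..<16::nat} else {})"
        using that by (intro card_mono) (auto simp: M\<^sub>2_def split: if_splits)
      then show ?thesis by (simp split: if_splits)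
    qed
  qed (use ab G K in \<open>auto simp: M\<^sub>1_def M\<^sub>2_def\<close>)
  moreover have "(\<Sum>i<16::nat. real (if i = 0 then 16 else 0) powr (1 - ?t)) = 16 powr (1 - ?t)"
    "(\<Sum>j<16::nat. real (if j = 0 then 15 else 0) powr ?t) = 15 powr ?t"
    by (simp_all add: lessThan_nat_numeral)
  ultimately have "cost_le (kronecker (M\<^sub>1 + M\<^sub>2) Z) a b
    (G * potential K a b * (16 powr (1 - ?t) + 15 powr ?t) * 1.0004)"
    using K(2) by simp
  moreover have "G * potential K a b * (16 powr (1 - ?t) + 15 powr ?t) * 1.0004 \<le> G * potential K a b * 7.8965 * 1.0004"
    using GP_nonneg tilted_bounds_near_half(2)[OF tilt_bounds(1) assms(1)] ab K
    by (intro mult_right_mono mult_left_mono) auto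
  ultimately have "cost_le (kronecker (M\<^sub>1 + M\<^sub>2) Z) a b (G * potential K a b * 7.8965 * 1.0004)"
    by (rule cost_le_mono)
  from cost_le_add[OF this core]
  have "cost_le (kronecker ?R Z) a b (G * potential K a b * 7.8965 * 1.0004 + 24.049 * G * potential K a b)"
    unfolding split using ab by (simp add: kronecker_add_left M\<^sub>1_def M\<^sub>2_def)
  moreover have "G * potential K a b * 7.8965 * 1.0004 + 24.049 * G * potential K a b \<le> 31.9488 * G * potential K a b"
    using mult_right_mono[of "7.8965 * 1.0004 + 24.049" "31.9488" "G * potential K a b"] GP_nonneg
    by (simp add: algebra_simps)
  ultimately show ?thesis
    by (rule cost_le_mono)
qed

end

section \<open>Circuits for the disjointness matrices\<close>

text \<open>All rows and columns in use have at most \<open>343\<close> nonzero entries, and the numerical estimates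
  leave room for a loss of a factor \<open>1.0004\<close> per step.\<close>

lemma exists_smoothing_parameter: "\<exists>K > 0. exp ((ln (343 :: real))\<^sup>2 / (4 * K)) = 1.0004"
proof (intro exI conjI)
  have "ln (1.0004 :: real) > 0" by simp
  then show "(ln (343 :: real))\<^sup>2 / (4 * ln 1.0004) > 0"
    by (intro divide_pos_pos) auto
  show "exp ((ln (343 :: real))\<^sup>2 / (4 * ((ln 343)\<^sup>2 / (4 * ln 1.0004)))) = 1.0004"
    using \<open>ln (1.0004 :: real) > 0\<close> by simp
qed

text \<open>Pending core factors stand in front of the untouched blocks. This family is closed under
  all recursive steps.\<close>

definition mixed_power :: "nat \<Rightarrow> nat \<Rightarrow> 'a::comm_semiring_1 mat" where
  "mixed_power n j = kronecker (kronecker_power core_mat j) (kronecker_power (disjointness_mat 4) n)"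

lemma transpose_mixed_power: "transpose_mat (mixed_power n j) = mixed_power n j"
  by (simp add: mixed_power_def transpose_kronecker transpose_kronecker_power transpose_core_mat transpose_disjointness_mat)

lemma kronecker_core_mixed_power: "kronecker core_mat (mixed_power n j) = mixed_power n (Suc j)"
  by (simp add: mixed_power_def kronecker_assoc)

lemma kronecker_core_cube_mixed_power: "kronecker (kronecker_power core_mat 3) (mixed_power n j) = mixed_power n (3 + j)"
  by (simp add: mixed_power_def kronecker_assoc kronecker_power_add del: kronecker_power.simps)

text \<open>The block to be expanded has to be moved past the pending core factors.\<close>

lemma cost_le_mixed_power_Suc:
  assumes "cost_le (kronecker (disjointness_mat 4) (mixed_power n j :: 'a::comm_semiring_1 mat)) a b r" "a \<ge> 0" "b \<ge> 0"
  shows "cost_le (mixed_power (Suc n) j :: 'a mat) a b r"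
  using cost_le_kronecker_swap[OF assms[unfolded mixed_power_def]] by (simp add: mixed_power_def)

lemma cost_le_mixed_power:
  assumes K: "K > 0" "exp ((ln 343)\<^sup>2 / (4 * K)) = 1.0004" and "a > 0" "b > 0"
  shows "cost_le (mixed_power n j :: 'a::comm_semiring_1 mat) a b
    (262144 * 31.9488 ^ n * 24.049 ^ j * potential K a b)"
  using assms(3,4)
\<comment> \<open>A block counts twice as much as a core factor, so replacing a block by a core also
  decreases the measure.\<close>
proof (induction "2 * n + j" arbitrary: n j a b rule: less_induct)
  case less
  \<comment> \<open>The constant is \<open>2 * 256 * 512\<close>, from the base case with at most
    two core factors.\<close>
  let ?G = "\<lambda>n j. 262144 * 31.9488 ^ n * 24.049 ^ j :: real"
  have IH: "cost_le (mixed_power n' j' :: 'a mat) x y (?G n' j' * potential K x y)"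
    if "2 * n' + j' < 2 * n + j" "x > 0" "y > 0" for n' j' x y
    using less.hyps[OF that] .
  have main: "cost_le (mixed_power n j :: 'a mat) a b (?G n j * potential K a b)" if ab: "a \<ge> b" "b > 0" for a b
  proof -
    consider m where "n = Suc m" | i where "n = 0" "j = 3 + i" | "n = 0" "j < 3"
      by (metis add.commute le_add_diff_inverse not_less not0_implies_Suc)
    then show ?thesis
    proof cases
      case (1 m)
      have G: "?G m j \<ge> 0" by simp
      have Z: "cost_le (mixed_power m j :: 'a mat) x y (?G m j * potential K x y)" if "x > 0" "y > 0" for x y
        by (intro IH) (use that 1 in auto)
      have "cost_le (kronecker (disjointness_mat 4) (mixed_power m j :: 'a mat)) a b (31.9488 * ?G m j * potential K a b)"
      proof (cases "tilt K a b \<le> 7 / 13")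
        case True
        have "cost_le (mixed_power m (Suc j) :: 'a mat) a b (?G m (Suc j) * potential K a b)"
          by (intro IH) (use 1 ab in auto)
        then have "cost_le (kronecker core_mat (mixed_power m j :: 'a mat)) a b (24.049 * ?G m j * potential K a b)"
          by (simp add: kronecker_core_mixed_power mult_ac)
        then show ?thesis
          by (rule cost_le_block_near[OF _ ab G K True, rotated]) (rule Z)
      next
        case False
        then show ?thesis
          by (intro cost_le_block_far[OF _ ab G K] Z) auto
      qed
      then show ?thesis
        using cost_le_mixed_power_Suc ab 1 by (fastforce simp: mult_ac)
    next
      case (2 i)
      have Z: "cost_le (mixed_power n i' :: 'a mat) x y (?G n i' * potential K x y)" if "x > 0" "y > 0" "i' < j" for x y i'
        by (intro IH) (use that in auto)
      show ?thesis
      proof (cases "tilt K a b \<le> 7 / 13")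
        case True
        have "cost_le (kronecker (kronecker_power core_mat 3) (mixed_power n i :: 'a mat)) a b
            (24.049 ^ 3 * ?G n i * potential K a b)"
          using 2 by (intro cost_le_core_cube[OF _ ab _ K True] Z) auto
        then show ?thesis
          using 2 by (simp add: kronecker_core_cube_mixed_power power_add mult_ac)
      next
        case False
        \<comment> \<open>In the far range one core factor is removed and the other
          \<open>2 + i\<close> wait for the new weights.\<close>
        have "cost_le (kronecker core_mat (mixed_power n (2 + i) :: 'a mat)) a b
            (24.049 * ?G n (2 + i) * potential K a b)"
          using 2 False by (intro cost_le_core_far[OF _ ab _ K] Z) auto
        then show ?thesis
          using 2 by (simp add: kronecker_core_mixed_power numeral_3_eq_3 mult_ac)
      qed
    next
      case 3
      let ?Z = "mixed_power n j :: 'a mat"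
      have "(16 :: nat) ^ j \<le> 16 ^ 2"
        using 3 by (intro power_increasing) auto
      then have "dim_row ?Z \<le> 256" "dim_col ?Z \<le> 256"
        using 3 by (simp_all add: mixed_power_def)
      then have dim: "real (dim_row ?Z) \<le> 256" "real (dim_col ?Z) \<le> 256"
        by simp_all
      have "cost_le ?Z a b ((a + b) * real (dim_row ?Z) * real (dim_row ?Z + dim_col ?Z))"
        using ab by (intro cost_le_trivial) auto
      moreover have "(a + b) * real (dim_row ?Z) * real (dim_row ?Z + dim_col ?Z) \<le>
          (2 * potential K a b) * 256 * 512"
        using le_potential_left[of a b K] le_potential_right[of a b K] ab dim
        by (intro mult_mono) auto
      moreover have "(2 * potential K a b) * 256 * 512 \<le> ?G n j * potential K a b"
        using 3 one_le_power[of "24.049 :: real" j] potential_pos[of a b K] ab by simp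
      ultimately show ?thesis
        using cost_le_mono order_trans by blast
    qed
  qed
  show ?case
  proof (cases "a \<ge> b")
    case True
    then show ?thesis
      using main less.prems by blast
  next
    case False
    \<comment> \<open>Mixed powers and the potential are symmetric, so transposition settles the
      opposite imbalance.\<close>
    then have "cost_le (mixed_power n j :: 'a mat) b a (?G n j * potential K b a)"
      using main less.prems by simp
    then show ?thesis
      using cost_le_transpose[of "mixed_power n j :: 'a mat"] less.prems
      by (simp add: transpose_mixed_power potential_commute[of a b])
  qed
qed

section \<open>The depth-two bound for all \<open>k\<close>\<close>

lemma disjointness_mat_add:
  "disjointness_mat (m + n) = kronecker (disjointness_mat m) (disjointness_mat n)"
  by (simp add: disjointness_mat_def kronecker_power_add)

lemma kronecker_power_disjointness_mat: "kronecker_power (disjointness_mat m) n = disjointness_mat (m * n)"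
  by (induction n) (simp_all add: disjointness_mat_def kronecker_power_add)

text \<open>Since \<open>31.9488 = 32 * 624 / 625\<close>, it is enough that
  \<open>2 \<le> (625 / 624) ^ 433\<close>, because \<open>5 - 1 / 433\<close> is below
  \<open>1.249424 * 4\<close>.\<close>

lemma block_rate_le: "31.9488 \<le> (2 :: real) powr (1.249424 * 4)"
proof -
  \<comment> \<open>The power is evaluated along \<open>433 = 1 + 16 * 9 * 3\<close>, rounding down
    in between to keep the numbers small.\<close>
  have "(2 :: real) \<le> 625 / 624 * 1.25933 ^ 3"
    by (simp add: power_divide)
  also have "\<dots> \<le> 625 / 624 * (1.025951 ^ 9) ^ 3"
    by (intro mult_left_mono power_mono) (simp_all add: power_divide)
  also have "\<dots> \<le> 625 / 624 * (((625 / 624) ^ 16) ^ 9) ^ 3"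
    by (intro mult_left_mono power_mono) (simp_all add: power_divide)
  also have "\<dots> = (625 / 624 :: real) ^ Suc 432"
    unfolding power_Suc power_mult[symmetric] by (simp del: power_Suc power_divide)
  finally have "(2 :: real) powr (1 / 433) \<le> 625 / 624"
    using powr_le_of_power_le[of 2 "625 / 624" 433 1] by (simp del: power_Suc)
  then have "(31.9488 :: real) \<le> 2 powr 5 / 2 powr (1 / 433)"
    by (simp add: powr_numeral field_simps)
  also have "\<dots> = 2 powr (5 - 1 / 433)"
    by (rule powr_diff[symmetric])
  also have "\<dots> \<le> 2 powr (1.249424 * 4)"
    by (intro powr_mono) auto
  finally show ?thesis .
qed

lemma disjointness_mat_cost:
  "\<exists>c \<ge> 0. \<forall>k. cost_le (disjointness_mat k :: 'a::comm_semiring_1 mat) 1 1 (c * 2 powr (1.249424 * real k))"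
proof -
  obtain K :: real where K: "K > 0" "exp ((ln 343)\<^sup>2 / (4 * K)) = 1.0004"
    using exists_smoothing_parameter by blast
  \<comment> \<open>The at most three factors left over by division by 4 form a matrix with at most
    \<open>8 * 8 = 64\<close> entries, factored trivially; the weights 64 absorb it.\<close>
  define c where "c = 262144 * potential K 64 64"
  have c: "c \<ge> 0"
    using potential_pos[of 64 64 K] by (simp add: c_def)
  have "cost_le (disjointness_mat k :: 'a mat) 1 1 (c * 2 powr (1.249424 * real k))" for k
  proof -
    define n r where "n = k div 4" and "r = k mod 4"
    have k: "k = r + 4 * n" and r: "r \<le> 3"
      by (auto simp: n_def r_def)
    let ?Z = "disjointness_mat (4 * n) :: 'a mat" and ?P = "disjointness_mat r :: 'a mat"
    have "mixed_power n 0 = ?Z"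
      by (simp add: mixed_power_def kronecker_power_disjointness_mat del: One_nat_def)
    then have "cost_le ?Z 64 64 (c * 31.9488 ^ n)"
      using cost_le_mixed_power[OF K, of 64 64 n 0, where 'a = 'a] by (simp add: c_def mult_ac)
    moreover have "nnz ?P \<le> 64" "nnz (1\<^sub>m (2 ^ r) :: 'a mat) \<le> 64"
    proof -
      have "(2 :: nat) ^ r \<le> 2 ^ 3"
        using r by (intro power_increasing) auto
      then show "nnz ?P \<le> 64" "nnz (1\<^sub>m (2 ^ r) :: 'a mat) \<le> 64"
        using nnz_le_dim[of ?P] nnz_one_le[of "2 ^ r", where 'a = 'a] mult_mono[of "2 ^ r" "8 :: nat" "2 ^ r" 8] by auto
    qed
    ultimately have "cost_le ?Z (1 * real (nnz ?P)) (1 * real (nnz (1\<^sub>m (2 ^ r) :: 'a mat))) (c * 31.9488 ^ n)"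
      by (elim cost_le_weights_mono) auto
    then have "cost_le (kronecker (?P * 1\<^sub>m (2 ^ r)) ?Z) 1 1 (c * 31.9488 ^ n)"
      by (rule cost_le_kronecker_product) auto
    moreover have "?P * 1\<^sub>m (2 ^ r) = ?P"
      by (rule right_mult_one_mat[of _ "2 ^ r"]) (auto intro!: carrier_matI)
    ultimately have "cost_le (disjointness_mat k :: 'a mat) 1 1 (c * 31.9488 ^ n)"
      by (simp add: k disjointness_mat_add)
    moreover have "(31.9488 :: real) ^ n \<le> (2 powr (1.249424 * 4)) ^ n"
      using block_rate_le by (rule power_mono) simp
    then have "(31.9488 :: real) ^ n \<le> 2 powr (1.249424 * (4 * real n))"
      by (simp add: powr_powr mult_ac flip: powr_realpow)
    moreover have "\<dots> \<le> 2 powr (1.249424 * real k)"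
      unfolding k by (intro powr_mono) auto
    ultimately show ?thesis
      using c by (meson cost_le_mono mult_left_mono order_trans)
  qed
  with c show ?thesis by blast
qed

section \<open>Composing circuits to larger even depth\<close>

lemma linear_circuit_imp_dims:
  assumes "linear_circuit d M As"
  shows "dim_row M = dim_row (hd As)" "dim_col M = dim_col (last As)"
proof -
  have "dim_row (foldr (*) Bs B) = dim_row (hd (Bs @ [B]))" "dim_col (foldr (*) Bs B) = dim_col B" for Bs and B :: "'a mat"
    by (induction Bs) auto
  then show "dim_row M = dim_row (hd As)" "dim_col M = dim_col (last As)"
    using assms by (auto simp: linear_circuit_def)
qed

lemma linear_circuit_Cons:
  assumes "linear_circuit d M As" "dim_col A = dim_row M"
  shows "linear_circuit (Suc d) (A * M) (A # As)"
  using assms linear_circuit_imp_dims(1)[OF assms(1)]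
  by (auto simp: linear_circuit_def successively_Cons)

lemma linear_circuit_single: "linear_circuit 1 M [M]"
  by (simp add: linear_circuit_def)

lemma kronecker_one_circuit:
  fixes As :: "'a::comm_semiring_1 mat list"
  assumes "linear_circuit d M As"
  shows "linear_circuit d (kronecker (1\<^sub>m n) M) (map (kronecker (1\<^sub>m n)) As)"
  using assms
proof (induction As arbitrary: d M)
  case (Cons A As)
  show ?case
  proof (cases "As = []")
    case True
    then show ?thesis
      using Cons.prems by (auto simp: linear_circuit_def)
  next
    case False
    define N where "N = foldr (*) (butlast As) (last As)"
    have N: "linear_circuit (length As) N As" "dim_col A = dim_row (hd As)" "M = A * N" "d = Suc (length As)"
      using Cons.prems False by (auto simp: linear_circuit_def N_def successively_Cons)
    have dim: "dim_col A = dim_row N"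
      using N linear_circuit_imp_dims(1) by metis
    have "linear_circuit d (kronecker (1\<^sub>m n) A * kronecker (1\<^sub>m n) N) (map (kronecker (1\<^sub>m n)) (A # As))"
      using linear_circuit_Cons[OF Cons.IH[OF N(1)], of "kronecker (1\<^sub>m n) A"] N(4) dim by simp
    moreover have "kronecker (1\<^sub>m n) A * kronecker (1\<^sub>m n) N = kronecker (1\<^sub>m n * 1\<^sub>m n) (A * N)"
      using dim by (subst kronecker_mult_mixed) auto
    ultimately show ?thesis
      using N(3) by simp
  qed
qed (simp add: linear_circuit_def)

lemma circuit_size_map_kronecker_one:
  fixes As :: "'a::semiring_1 mat list"
  shows "circuit_size (map (kronecker (1\<^sub>m n)) As) \<le> n * circuit_size As"
proof (induction As)
  case (Cons A As)
  have "nnz (kronecker (1\<^sub>m n) A) \<le> n * nnz A"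
    using nnz_kronecker_le[of "1\<^sub>m n" A] nnz_one_le[of n, where 'a = 'a] by (meson le_trans mult_le_mono1)
  then show ?case
    using Cons by (simp add: circuit_size_def distrib_left)
qed (simp add: circuit_size_def)

text \<open>With \<open>M = U * V\<close>, the product is \<open>kronecker U 1\<close> times
  \<open>kronecker V 1\<close> times \<open>kronecker 1 N\<close>, and the circuit of
  \<open>N\<close> is lifted factor by factor.\<close>

lemma kronecker_circuit:
  fixes M N :: "'a::comm_semiring_1 mat"
  assumes "cost_le M 1 1 r" "linear_circuit d N As"
    and "dim_row M = dim_col M" "dim_row N = dim_col N"
  shows "\<exists>Bs. linear_circuit (2 + d) (kronecker M N) Bs \<and>
    real (circuit_size Bs) \<le> r * real (dim_row N) + real (dim_row M) * real (circuit_size As)"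
proof -
  obtain U V where UV: "dim_col U = dim_row V" "M = U * V" "1 * real (nnz U) + 1 * real (nnz V) \<le> r"
    using assms(1) by (rule cost_leE)
  let ?m = "dim_row M" and ?n = "dim_row N"
  let ?U = "kronecker U (1\<^sub>m ?n)" and ?V = "kronecker V (1\<^sub>m ?n)" and ?I = "1\<^sub>m ?m :: 'a mat"
  let ?Bs = "?U # ?V # map (kronecker ?I) As"
  have dims: "dim_col V = ?m" "dim_row U = ?m"
    using UV(2) assms(3) by auto
  have "linear_circuit d (kronecker ?I N) (map (kronecker ?I) As)"
    by (rule kronecker_one_circuit[OF assms(2)])
  then have "linear_circuit (Suc d) (?V * kronecker ?I N) (?V # map (kronecker ?I) As)"
    by (rule linear_circuit_Cons) (simp add: dims)
  then have "linear_circuit (Suc (Suc d)) (?U * (?V * kronecker ?I N)) ?Bs"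
    by (rule linear_circuit_Cons) (simp add: UV(1))
  moreover have "?V * kronecker ?I N = kronecker (V * ?I) (1\<^sub>m ?n * N)"
    using dims by (subst kronecker_mult_mixed) auto
  moreover have "V * ?I = V" "1\<^sub>m ?n * N = N"
    using dims by (auto intro!: right_mult_one_mat[of _ "dim_row V"] left_mult_one_mat[of _ _ "dim_col N"] carrier_matI)
  moreover have "?U * kronecker V N = kronecker (U * V) (1\<^sub>m ?n * N)"
    using UV(1) by (subst kronecker_mult_mixed) auto
  ultimately have "linear_circuit (2 + d) (kronecker M N) ?Bs"
    using UV(2) by simp
  moreover have "real (circuit_size ?Bs) \<le> r * real ?n + real ?m * real (circuit_size As)"
  proof -
    have "nnz ?U \<le> nnz U * ?n" "nnz ?V \<le> nnz V * ?n"
      using nnz_kronecker_le[of U "1\<^sub>m ?n"] nnz_kronecker_le[of V "1\<^sub>m ?n"] nnz_one_le[of ?n, where 'a = 'a]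
      by (meson le_trans mult_le_mono2)+
    then have "circuit_size ?Bs \<le> (nnz U + nnz V) * ?n + ?m * circuit_size As"
      using circuit_size_map_kronecker_one[of ?m As] by (simp add: circuit_size_def distrib_right)
    then have "real (circuit_size ?Bs) \<le> (real (nnz U) + real (nnz V)) * real ?n + real ?m * real (circuit_size As)"
      by (simp flip: of_nat_add of_nat_mult)
    also have "\<dots> \<le> r * real ?n + real ?m * real (circuit_size As)"
      using UV(3) by (intro add_right_mono mult_right_mono) auto
    finally show ?thesis .
  qed
  ultimately show ?thesis by blast
qed

text \<open>Splitting the \<open>k\<close> Kronecker factors into \<open>e + 1\<close> groups and applying the depth-two circuit of one
  group after the other.\<close>

lemma disjointness_mat_circuit_of_groups:
  fixes c :: real
  assumes cost: "\<And>k. cost_le (disjointness_mat k :: 'a::comm_semiring_1 mat) 1 1 (c * 2 powr (1.249424 * real k))"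
    and c: "c \<ge> 0" and "q \<le> p"
  shows "\<exists>As. linear_circuit (2 * Suc e) (disjointness_mat (e * q + p) :: 'a mat) As \<and>
    real (circuit_size As) \<le> c * real (Suc e) * 2 powr (real (e * q + p) + 0.249424 * real p)"
proof (induction e)
  case 0
  obtain U V where UV: "dim_col U = dim_row V" "(disjointness_mat p :: 'a mat) = U * V"
    "1 * real (nnz U) + 1 * real (nnz V) \<le> c * 2 powr (1.249424 * real p)"
    using cost[of p] by (rule cost_leE)
  have "linear_circuit 2 (disjointness_mat p) [U, V]"
    using linear_circuit_Cons[OF linear_circuit_single UV(1)] UV(2) by (simp add: numeral_2_eq_2)
  moreover have "real (circuit_size [U, V]) \<le> c * 2 powr (1.249424 * real p)"
    using UV(3) by (simp add: circuit_size_def)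
  moreover have "c * 2 powr (1.249424 * real p) \<le> c * 2 powr (real p + 0.249424 * real p)"
    using c by (intro mult_left_mono powr_mono) auto
  ultimately show ?case
    by (intro exI[of _ "[U, V]"]) simp
next
  case (Suc e)
  let ?k = "e * q + p" and ?x = "0.249424 * real p"
  obtain As where As: "linear_circuit (2 * Suc e) (disjointness_mat ?k :: 'a mat) As"
    "real (circuit_size As) \<le> c * real (Suc e) * 2 powr (real ?k + ?x)"
    using Suc.IH by blast
  obtain Bs where Bs: "linear_circuit (2 + 2 * Suc e) (kronecker (disjointness_mat q) (disjointness_mat ?k) :: 'a mat) Bs"
    "real (circuit_size Bs) \<le> c * 2 powr (1.249424 * real q) * real (2 ^ ?k) + real (2 ^ q) * real (circuit_size As)"
    using kronecker_circuit[OF cost[of q] As(1)] by auto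
  have two: "real (2 ^ n) = 2 powr real n" for n
    by (simp add: powr_realpow)
  have "c * 2 powr (1.249424 * real q) * real (2 ^ ?k) = c * 2 powr (real (q + ?k) + 0.249424 * real q)"
    unfolding two by (simp add: mult.assoc algebra_simps flip: powr_add)
  \<comment> \<open>Beyond the linear exponent a group of \<open>q\<close> factors costs an excess
    of \<open>0.249424 * q\<close>, which the largest group dominates.\<close>
  also have "\<dots> \<le> c * 2 powr (real (q + ?k) + ?x)"
    using c \<open>q \<le> p\<close> by (intro mult_left_mono powr_mono) auto
  finally have 1: "c * 2 powr (1.249424 * real q) * real (2 ^ ?k) \<le> c * 2 powr (real (q + ?k) + ?x)" .
  have "real (2 ^ q) * real (circuit_size As) \<le> 2 powr real q * (c * real (Suc e) * 2 powr (real ?k + ?x))"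
    unfolding two using As(2) by (intro mult_left_mono) auto
  also have "\<dots> = c * real (Suc e) * 2 powr (real (q + ?k) + ?x)"
    by (simp add: powr_add mult_ac)
  finally have "real (circuit_size Bs) \<le> c * real (Suc (Suc e)) * 2 powr (real (q + ?k) + ?x)"
    using Bs(2) 1 by (simp add: algebra_simps)
  then show ?case
    using Bs(1) by (intro exI[of _ Bs]) (simp add: disjointness_mat_add[symmetric] add.assoc)
qed

lemma disjointness_mat_circuit:
  assumes "d > 0" "even d"
  shows "\<exists>C :: nat \<Rightarrow> 'a::comm_semiring_1 mat list.
    (\<forall>k\<ge>1. linear_circuit d (disjointness_mat k) (C k)) \<and>
    (\<lambda>k. real (circuit_size (C k))) \<in> O(\<lambda>k. (2 ^ k :: real) powr (1 + 0.498848 / real d))"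
proof -
  obtain c where c: "c \<ge> 0"
    and cost: "\<And>k. cost_le (disjointness_mat k :: 'a mat) 1 1 (c * 2 powr (1.249424 * real k))"
    using disjointness_mat_cost[where 'a = 'a] by blast
  obtain e where d: "d = 2 * Suc e"
    using assms by (metis evenE gr0_implies_Suc nat_0_less_mult_iff)
  \<comment> \<open>The largest group has at most \<open>k / Suc e + Suc e\<close> factors; the
    additive rounding term goes into \<open>B\<close>.\<close>
  define B where "B = c * real (Suc e) * 2 powr (0.249424 * real (Suc e))"
  have "\<exists>As. linear_circuit d (disjointness_mat k :: 'a mat) As \<and>
    real (circuit_size As) \<le> B * (2 ^ k) powr (1 + 0.498848 / real d)" for k
  proof -
    \<comment> \<open>There are \<open>e\<close> groups of \<open>q\<close> factors, and one group
      takes the remaining \<open>p\<close>.\<close>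
    define q where "q = k div Suc e"
    define p where "p = k - e * q"
    have q: "Suc e * q \<le> k" "k < Suc e * q + Suc e"
      using mult_div_mod_eq[of "Suc e" k] mod_less_divisor[of "Suc e" k] unfolding q_def by linarith+
    have k: "e * q + p = k"
      using q(1) by (simp add: p_def)
    have "q \<le> p"
      using q(1) by (simp add: p_def)
    have "real p \<le> real k / real (Suc e) + real (Suc e)"
    proof -
      have "k \<le> Suc e * q + e"
        using q(2) by simp
      then have "real k \<le> real (Suc e) * real q + real e"
        by (metis of_nat_add of_nat_le_iff of_nat_mult)
      then have "real e * real k \<le> real e * (real (Suc e) * real q + real e)"
        by (rule mult_left_mono) simp
      moreover have p: "real p = real k - real e * real q"
        unfolding k[symmetric] by simp
      have "real (Suc e) * real p = real k + real e * real k - real e * (real (Suc e) * real q)"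
        unfolding p by (simp add: algebra_simps)
      ultimately have "real (Suc e) * real p \<le> real k + real e * real e"
        by (simp only: distrib_left)
      also have "\<dots> \<le> real k + real (Suc e) * real (Suc e)"
        by (simp add: algebra_simps)
      finally show ?thesis
        by (simp add: field_simps)
    qed
    then have "real k + 0.249424 * real p \<le> real k + 0.249424 * (real k / real (Suc e) + real (Suc e))"
      by simp
    also have "\<dots> = real k * (1 + 0.498848 / real d) + 0.249424 * real (Suc e)"
      by (simp add: d field_simps)
    finally have "2 powr (real k + 0.249424 * real p) \<le>
        2 powr (real k * (1 + 0.498848 / real d) + 0.249424 * real (Suc e))"
      by (rule powr_mono) simp
    also have "\<dots> = 2 powr (0.249424 * real (Suc e)) * (2 ^ k) powr (1 + 0.498848 / real d)"
    proof -
      have *: "(2 ^ k :: real) powr y = 2 powr (real k * y)" for y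
        by (simp add: powr_powr flip: powr_realpow)
      show ?thesis
        unfolding * powr_add[symmetric] by (simp only: add.commute)
    qed
    finally have "c * real (Suc e) * 2 powr (real k + 0.249424 * real p) \<le> B * (2 ^ k) powr (1 + 0.498848 / real d)"
      using c mult_left_mono[of _ _ "c * real (Suc e)"] by (simp add: B_def mult.assoc)
    moreover obtain As where As: "linear_circuit d (disjointness_mat k :: 'a mat) As"
      "real (circuit_size As) \<le> c * real (Suc e) * 2 powr (real k + 0.249424 * real p)"
      using disjointness_mat_circuit_of_groups[OF cost c \<open>q \<le> p\<close>, of e] unfolding k d by blast
    ultimately show ?thesis
      by force
  qed
  then obtain C :: "nat \<Rightarrow> 'a mat list" where C: "\<And>k. linear_circuit d (disjointness_mat k) (C k)"
    "\<And>k. real (circuit_size (C k)) \<le> B * (2 ^ k) powr (1 + 0.498848 / real d)"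
    by metis
  have "(\<lambda>k. real (circuit_size (C k))) \<in> O(\<lambda>k. (2 ^ k :: real) powr (1 + 0.498848 / real d))"
    by (rule bigoI[of _ B]) (use C(2) in auto)
  with C(1) show ?thesis by blast
qed

theorem theorem1p1:
  shows "(\<exists>C :: nat \<Rightarrow> 'a::field mat list.
            (\<forall>k\<ge>1. linear_circuit 2 (disjointness_mat k) (C k)) \<and>
            (\<lambda>k. real (circuit_size (C k))) \<in> O(\<lambda>k. (2 ^ k :: real) powr 1.249424)) \<and>
         (\<forall>d::nat. d > 0 \<and> even d \<longrightarrow>
            (\<exists>C :: nat \<Rightarrow> 'a mat list.
              (\<forall>k\<ge>1. linear_circuit d (disjointness_mat k) (C k)) \<and>
              (\<lambda>k. real (circuit_size (C k)))
                \<in> O(\<lambda>k. (2 ^ k :: real) powr (1 + 0.498848 / real d))))"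
  \<comment> \<open>Depth two is the case \<open>d = 2\<close>, as
    \<open>1 + 0.498848 / 2 = 1.249424\<close>.\<close>
  using disjointness_mat_circuit[of 2, where 'a = 'a] disjointness_mat_circuit[where 'a = 'a] by simp

end
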